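(* Let $G=K_{t_1,\ldots,t_k}$ ($k\ge2$) be a complete multipartite graph with parts $V_1,\ldots,V_k$, $|V_i|=t_i$. Let $S$ be a non-empty subset of the edge set of $G$, and let $H$ be the subgraph induced by $S$ (its vertex set is the set of endpoints of edges in $S$ and its edge set is $S$). Let $U_i=V(H)\cap V_i$ for $1\le i\le k$. If $|V_i|\ge 2\lambda(H)\,|U_i|$ for every $i$, then $\mathcal{E}(G-S)>\mathcal{E}(G)$.
   Context: All graphs are simple. $\lambda(H)$ denotes the spectral radius (largest adjacency eigenvalue) of $H$. The energy $\mathcal{E}(G)$ is the sum of the absolute values of the adjacency eigenvalues of $G$. $G-S$ is the graph obtained from $G$ by deleting the edges in $S$ (keeping all vertices). *)

theory Defs
  imports
    "Jordan_Normal_Form.Char_Poly"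
    "HOL-Library.Disjoint_Sets"
begin

section \<open>Finite simple graphs\<close>

record 'a ugraph =
  verts :: "'a set"
  edges :: "'a set set"

definition simple_graph :: "'a ugraph \<Rightarrow> bool" where
  "simple_graph G \<longleftrightarrow> finite (verts G) \<and> (\<forall>e\<in>edges G. e \<subseteq> verts G \<and> card e = 2)"

definition complete_multipartite :: "nat \<Rightarrow> (nat \<Rightarrow> 'a set) \<Rightarrow> 'a ugraph" where
  "complete_multipartite k V =
     \<lparr>verts = (\<Union>i\<in>{1..k}. V i),
      edges = {{u, v} | u v i j. i \<in> {1..k} \<and> j \<in> {1..k} \<and> i \<noteq> j \<and> u \<in> V i \<and> v \<in> V j}\<rparr>"

definition delete_edges :: "'a ugraph \<Rightarrow> 'a set set \<Rightarrow> 'a ugraph" where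
  "delete_edges G S = \<lparr>verts = verts G, edges = edges G - S\<rparr>"

definition edge_induced_subgraph :: "'a set set \<Rightarrow> 'a ugraph" where
  "edge_induced_subgraph S = \<lparr>verts = \<Union>S, edges = S\<rparr>"

lemma simple_graph_complete_multipartite:
  assumes "\<And>i. i \<in> {1..k} \<Longrightarrow> finite (V i)" and "disjoint_family_on V {1..k}"
  shows "simple_graph (complete_multipartite k V)"
proof -
  have "card {u, v} = 2"
    if "i \<in> {1..k}" "j \<in> {1..k}" "i \<noteq> j" "u \<in> V i" "v \<in> V j" for u v i j
  proof -
    have "V i \<inter> V j = {}"
      using assms(2) that by (auto simp: disjoint_family_on_def)
    then have "u \<noteq> v" using that by auto
    then show ?thesis by simp
  qed
  then show ?thesis
    using assms(1) unfolding simple_graph_def complete_multipartite_def by auto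
qed

lemma simple_graph_delete_edges:
  "simple_graph G \<Longrightarrow> simple_graph (delete_edges G S)"
  by (auto simp: simple_graph_def delete_edges_def)

lemma simple_graph_edge_induced_subgraph:
  assumes "simple_graph G" "S \<subseteq> edges G"
  shows "simple_graph (edge_induced_subgraph S)"
proof -
  have "\<Union>S \<subseteq> verts G" using assms by (auto simp: simple_graph_def)
  then have "finite (\<Union>S)"
    using assms(1) by (auto simp: simple_graph_def intro: finite_subset)
  then show ?thesis
    using assms by (auto simp: simple_graph_def edge_induced_subgraph_def)
qed


section \<open>Adjacency spectrum, spectral radius and energy\<close>

definition adj_mat_of :: "'a list \<Rightarrow> 'a set set \<Rightarrow> real mat" where
  "adj_mat_of xs E =
     mat (length xs) (length xs) (\<lambda>(i, j). if {xs ! i, xs ! j} \<in> E then 1 else 0)"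

text \<open>Matrices are indexed by natural numbers, so the vertices are enumerated in an arbitrary
  order; by \<open>char_poly_adj_mat_of\<close> below the spectrum does not depend on the choice.\<close>

definition adj_mat :: "'a ugraph \<Rightarrow> real mat" where
  "adj_mat G = adj_mat_of (SOME xs. distinct xs \<and> set xs = verts G) (edges G)"

text \<open>The eigenvalues with multiplicity. No eigenvalue is lost by taking only the real roots:
  see \<open>size_adj_spectrum\<close> below.\<close>

definition adj_spectrum :: "'a ugraph \<Rightarrow> real multiset" where
  "adj_spectrum G = proots (char_poly (adj_mat G))"

text \<open>The spectral radius is the largest adjacency eigenvalue; the maximum is over a finite
  non-empty set as soon as the graph has a vertex (\<open>eigenvalues_finite_nonempty\<close>).\<close>

definition graph_spectral_radius :: "'a ugraph \<Rightarrow> real" where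
  "graph_spectral_radius G = Max {x. eigenvalue (adj_mat G) x}"

definition graph_energy :: "'a ugraph \<Rightarrow> real" where
  "graph_energy G = (\<Sum>x\<in>#adj_spectrum G. \<bar>x\<bar>)"

lemma adj_mat_of_carrier: "adj_mat_of xs E \<in> carrier_mat (length xs) (length xs)"
  by (simp add: adj_mat_of_def)

lemma char_poly_adj_mat_of:
  assumes "distinct xs" "distinct ys" "set xs = set ys"
  shows "char_poly (adj_mat_of xs E) = char_poly (adj_mat_of ys E)"
proof (rule char_poly_similar)
  let ?n = "length xs"
  have len: "length ys = ?n"
    using assms by (metis distinct_card)
  have "\<exists>j<?n. xs ! i = ys ! j" if "i < ?n" for i
    using that assms(3) len by (metis in_set_conv_nth)
  then obtain p where p: "p i < ?n" "xs ! i = ys ! p i" if "i < ?n" for i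
    by metis
  have p_inj: "p i = p j \<longleftrightarrow> i = j" if "i < ?n" "j < ?n" for i j
    using that p assms(1) by (metis nth_eq_iff_index_eq)
  define P :: "real mat" where "P = mat ?n ?n (\<lambda>(i, j). if j = p i then 1 else 0)"
  define Q :: "real mat" where "Q = mat ?n ?n (\<lambda>(i, j). if i = p j then 1 else 0)"
  let ?A = "adj_mat_of xs E" and ?B = "adj_mat_of ys E"
  have carr: "P \<in> carrier_mat ?n ?n" "Q \<in> carrier_mat ?n ?n"
    "?A \<in> carrier_mat ?n ?n" "?B \<in> carrier_mat ?n ?n"
    using adj_mat_of_carrier[of xs E] adj_mat_of_carrier[of ys E] len
    by (auto simp: P_def Q_def)
  have delta: "(if a = b then 1 else 0) * c = (if a = b then c else 0)"
    "c * (if a = b then 1 else 0) = (if a = b then c else 0)" for a b :: nat and c :: real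
    by auto
  have PQ: "P * Q = 1\<^sub>m ?n"
    by (rule eq_matI) (auto simp: P_def Q_def scalar_prod_def delta p(1) p_inj)
  have QP: "Q * P = 1\<^sub>m ?n"
    using mat_mult_left_right_inverse[OF carr(1,2) PQ] .
  have PB: "P * ?B = mat ?n ?n (\<lambda>(i, j). ?B $$ (p i, j))"
    using carr by (intro eq_matI) (auto simp: P_def scalar_prod_def delta p(1))
  have "P * ?B * Q = mat ?n ?n (\<lambda>(i, j). ?B $$ (p i, p j))"
    unfolding PB by (intro eq_matI) (auto simp: Q_def scalar_prod_def delta p(1))
  also have "\<dots> = ?A"
    by (intro eq_matI) (auto simp: adj_mat_of_def len p)
  finally have "?A = P * ?B * Q" ..
  with PQ QP carr show "similar_mat ?A ?B"
    by (intro similar_matI[of _ _ P Q ?n]) auto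
qed

lemma adj_mat_eq:
  assumes "finite (verts G)"
  obtains xs where "distinct xs" "set xs = verts G" "adj_mat G = adj_mat_of xs (edges G)"
proof -
  have "\<exists>xs. distinct xs \<and> set xs = verts G"
    using finite_distinct_list[OF assms] by blast
  from someI_ex[OF this] show ?thesis
    using that unfolding adj_mat_def by blast
qed

lemma adj_mat_carrier:
  assumes "finite (verts G)"
  shows "adj_mat G \<in> carrier_mat (card (verts G)) (card (verts G))"
  using adj_mat_eq[OF assms] adj_mat_of_carrier by (metis distinct_card)

lemma set_adj_spectrum:
  assumes "finite (verts G)"
  shows "set_mset (adj_spectrum G) = {x. eigenvalue (adj_mat G) x}"
proof -
  note A = adj_mat_carrier[OF assms]
  have "char_poly (adj_mat G) \<noteq> 0"
    using degree_monic_char_poly[OF A] by auto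
  then show ?thesis
    by (simp add: adj_spectrum_def eigenvalue_root_char_poly[OF A])
qed

lemma eigenvalue_symmetric_real:
  fixes A :: "real mat"
  assumes A: "A \<in> carrier_mat n n"
    and sym: "\<And>i j. i < n \<Longrightarrow> j < n \<Longrightarrow> A $$ (i, j) = A $$ (j, i)"
    and ev: "eigenvalue (map_mat complex_of_real A) z"
  shows "z \<in> \<real>"
proof -
  let ?B = "map_mat complex_of_real A"
  obtain v where v: "v \<in> carrier_vec n" "v \<noteq> 0\<^sub>v n" and eq: "?B *\<^sub>v v = z \<cdot>\<^sub>v v"
    using ev A by (auto simp: eigenvalue_def eigenvector_def)
  have row: "(\<Sum>j<n. of_real (A $$ (i, j)) * v $ j) = z * v $ i" if "i < n" for i
  proof -
    have "(?B *\<^sub>v v) $ i = (\<Sum>j<n. of_real (A $$ (i, j)) * v $ j)"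
      using that A v(1) by (auto simp: scalar_prod_def atLeast0LessThan intro!: sum.cong)
    then show ?thesis using eq that v(1) by simp
  qed
  define N where "N = (\<Sum>i<n. v $ i * cnj (v $ i))"
  define q where "q = (\<Sum>i<n. \<Sum>j<n. of_real (A $$ (i, j)) * v $ j * cnj (v $ i))"
  have q: "q = z * N"
    unfolding q_def N_def sum_distrib_left
    by (intro sum.cong refl) (simp add: sum_distrib_right[symmetric] row mult.assoc[symmetric])
  have "cnj q = (\<Sum>i<n. \<Sum>j<n. of_real (A $$ (i, j)) * v $ i * cnj (v $ j))"
    by (simp add: q_def mult_ac)
  also have "\<dots> = (\<Sum>j<n. \<Sum>i<n. of_real (A $$ (i, j)) * v $ i * cnj (v $ j))"
    by (rule sum.swap)
  also have "\<dots> = q"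
    unfolding q_def by (intro sum.cong refl) (simp add: sym)
  finally have "cnj q = q" .
  moreover have N: "N = of_real (\<Sum>i<n. (cmod (v $ i))\<^sup>2)"
    by (simp add: N_def complex_norm_square[symmetric])
  moreover have "N \<noteq> 0"
  proof
    assume "N = 0"
    then have "(\<Sum>i<n. (cmod (v $ i))\<^sup>2) = 0" using N by (metis of_real_eq_0_iff)
    then have "\<forall>i<n. v $ i = 0" by (simp add: sum_nonneg_eq_0_iff)
    then have "v = 0\<^sub>v n" using v(1) by (intro eq_vecI) auto
    with v(2) show False ..
  qed
  ultimately have "cnj z = z" using q by (auto simp del: of_real_sum)
  then show ?thesis by (simp add: Reals_cnj_iff)
qed

lemma size_adj_spectrum:
  assumes "finite (verts G)"
  shows "size (adj_spectrum G) = card (verts G)"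
proof -
  let ?n = "card (verts G)" and ?c = "complex_of_real"
  let ?A = "adj_mat G"
  note A = adj_mat_carrier[OF assms]
  obtain xs where xs: "distinct xs" "set xs = verts G" "?A = adj_mat_of xs (edges G)"
    using adj_mat_eq[OF assms] .
  have sym: "?A $$ (i, j) = ?A $$ (j, i)" if "i < ?n" "j < ?n" for i j
    using that distinct_card[OF xs(1)] by (simp add: xs adj_mat_of_def insert_commute)
  have B: "map_mat ?c ?A \<in> carrier_mat ?n ?n" using A by simp
  obtain as where as: "char_poly (map_mat ?c ?A) = (\<Prod>a\<leftarrow>as. [:- a, 1:])" "length as = ?n"
    using char_poly_factorized[OF B] by blast
  have "a \<in> \<real>" if "a \<in> set as" for a
  proof (rule eigenvalue_symmetric_real[OF A sym])
    show "eigenvalue (map_mat ?c ?A) a"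
      unfolding eigenvalue_root_char_poly[OF B] as(1)
      using that by (auto simp: poly_prod_list prod_list_zero_iff image_iff)
  qed auto
  then have as_Re: "map (\<lambda>a. ?c (Re a)) as = as"
    by (simp add: map_idI)
  interpret c: map_poly_inj_comm_ring_hom ?c ..
  have lin: "map_poly ?c [:- r, 1:] = [:- ?c r, 1:]" for r
    by simp
  have "map_poly ?c (\<Prod>r\<leftarrow>map Re as. [:- r, 1:]) = (\<Prod>a\<leftarrow>map (\<lambda>a. ?c (Re a)) as. [:- a, 1:])"
    unfolding c.hom_prod_list map_map comp_def lin ..
  also have "\<dots> = char_poly (map_mat ?c ?A)"
    unfolding as_Re as(1) ..
  also have "\<dots> = map_poly ?c (char_poly ?A)"
    by (rule of_real_hom.char_poly_hom[OF A])
  finally have "char_poly ?A = (\<Prod>r\<leftarrow>map Re as. [:- r, 1:])"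
    using c.injectivity by metis
  moreover have "size (proots (\<Prod>r\<leftarrow>rs. [:- r, 1:])) = length rs" for rs :: "real list"
  proof (induction rs)
    case (Cons r rs)
    have "(\<Prod>r\<leftarrow>rs. [:- r, 1:]) \<noteq> 0"
      by (auto simp: prod_list_zero_iff)
    then have "proots (\<Prod>r\<leftarrow>r # rs. [:- r, 1:])
        = proots [:- r, 1:] + proots (\<Prod>r\<leftarrow>rs. [:- r, 1:])"
      by (simp only: list.map prod_list.Cons) (rule proots_mult; simp)
    then show ?case using Cons by simp
  qed simp
  ultimately have "size (adj_spectrum G) = length (map Re as)"
    unfolding adj_spectrum_def by metis
  then show ?thesis
    by (simp add: as(2))
qed

lemma eigenvalues_finite_nonempty:
  assumes "finite (verts G)" "verts G \<noteq> {}"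
  shows "finite {x. eigenvalue (adj_mat G) x}" "{x. eigenvalue (adj_mat G) x} \<noteq> {}"
proof -
  have "adj_spectrum G \<noteq> {#}"
    using size_adj_spectrum[OF assms(1)] assms by auto
  then show "finite {x. eigenvalue (adj_mat G) x}" "{x. eigenvalue (adj_mat G) x} \<noteq> {}"
    using set_adj_spectrum[OF assms(1)] by (metis finite_set_mset, metis set_mset_eq_empty_iff)
qed

end

theory Submission
  imports Defs "Jordan_Normal_Form.Schur_Decomposition" "HOL-Analysis.Convex"
begin

text \<open>Write \<open>A\<close> for the adjacency matrix of \<open>G\<close>, \<open>B\<close> for that of \<open>H\<close> and \<open>\<lambda>\<close> for \<open>\<lambda>(H)\<close>. Since traces
  vanish, half the energy of \<open>G - S\<close> is the maximum of \<open>tr ((A - B) M)\<close> over all \<open>0 \<le> M \<le> I\<close> (Ky Fan),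
  while half the energy of \<open>G\<close> is its only positive eigenvalue \<open>\<mu>\<close>, with a unit eigenvector \<open>x\<close> that
  is constant on the parts. Let \<open>K\<close> be the averaging over the parts. The size condition gives
  \<open>x\<^sup>T B x \<le> 1/2\<close>, so the rank one choice \<open>M = x x\<^sup>T\<close> loses at most \<open>1/2\<close> against \<open>\<mu>\<close>. This is
  compensated on the range of \<open>I - K\<close>, on which the form of \<open>A\<close> vanishes.

  If some vertex has degree at least two in \<open>H\<close>, then \<open>\<lambda> \<ge> 4/3\<close>. Let \<open>h\<close> be the Perron vector of \<open>H\<close>
  and \<open>z\<close> the normalisation of \<open>h - K h\<close>. As \<open>(A - B)(I - K)\<close> has trace zero, the choice
  \<open>M = x x\<^sup>T + (I - K) - z z\<^sup>T\<close> yields \<open>\<mu> - x\<^sup>T B x + z\<^sup>T B z\<close>, where \<open>z\<^sup>T B z > 1/2\<close>.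

  Otherwise \<open>H\<close> is a matching. For an edge \<open>ad\<close> of \<open>H\<close> let \<open>g = e\<^sub>a - e\<^sub>d\<close> and let \<open>y\<close> be the
  normalisation of \<open>g - K g\<close>. Then \<open>- y\<^sup>T B y \<ge> 1/2\<close>, so \<open>M = x x\<^sup>T + y y\<^sup>T\<close> yields at least \<open>\<mu>\<close>.
  Equality would put \<open>(A - B) x\<close> in the span of \<open>x\<close> and \<open>y\<close>, which is refuted at the vertices
  outside \<open>H\<close>.\<close>

section \<open>Spectral theorem for real symmetric matrices\<close>

text \<open>Over the complex numbers the polynomial splits, and symmetry makes every root real. The
  embedding of real polynomials is injective, so the factorisation descends.\<close>

lemma char_poly_splits_symmetric:
  fixes A :: "real mat"
  assumes A: "A \<in> carrier_mat n n"
    and sym: "\<And>i j. i < n \<Longrightarrow> j < n \<Longrightarrow> A $$ (i, j) = A $$ (j, i)"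
  obtains rs where "char_poly A = (\<Prod>r\<leftarrow>rs. [:- r, 1:])"
proof -
  let ?c = complex_of_real
  let ?B = "map_mat ?c A"
  have B: "?B \<in> carrier_mat n n" using A by simp
  obtain as where as: "char_poly ?B = (\<Prod>a\<leftarrow>as. [:- a, 1:])"
    using char_poly_factorized[OF B] by blast
  have "a \<in> \<real>" if "a \<in> set as" for a
    using that eigenvalue_symmetric_real[OF A sym]
    unfolding eigenvalue_root_char_poly[OF B] as
    by (auto simp: poly_prod_list prod_list_zero_iff image_iff)
  then have Re: "map (\<lambda>a. ?c (Re a)) as = as"
    by (simp add: map_idI)
  interpret c: map_poly_inj_comm_ring_hom ?c ..
  have lin: "map_poly ?c [:- r, 1:] = [:- ?c r, 1:]" for r
    by simp
  have "map_poly ?c (\<Prod>r\<leftarrow>map Re as. [:- r, 1:]) = (\<Prod>a\<leftarrow>map (\<lambda>a. ?c (Re a)) as. [:- a, 1:])"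
    unfolding c.hom_prod_list map_map comp_def lin ..
  also have "\<dots> = map_poly ?c (char_poly A)"
    unfolding Re as[symmetric] by (rule of_real_hom.char_poly_hom[OF A])
  finally show ?thesis
    using c.injectivity that by metis
qed

text \<open>Schur triangularisation writes \<open>A = P * B * Q\<close> with the roots on the
  diagonal of \<open>B\<close>. Cyclicity of the trace and \<open>Q * P = I\<close> then remove
  \<open>P\<close> and \<open>Q\<close>.\<close>

lemma trace_eq_sum_list_roots:
  fixes A :: "real mat"
  assumes A: "A \<in> carrier_mat n n" and split: "char_poly A = (\<Prod>r\<leftarrow>rs. [:- r, 1:])"
  shows "(\<Sum>i<n. A $$ (i, i)) = sum_list rs" "length rs = n"
proof -
  obtain B P Q where "schur_decomposition A rs = (B, P, Q)"
    by (metis prod_cases3)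
  from schur_decomposition[OF A split this]
  have wit: "similar_mat_wit A B P Q" and diag: "diag_mat B = rs" by auto
  note w = similar_mat_witD2[OF A wit]
  show len: "length rs = n" using diag w(5) by (auto simp: diag_mat_def)
  have "(\<Sum>i<n. A $$ (i, i)) = (\<Sum>i<n. \<Sum>k<n. \<Sum>l<n. P $$ (i, k) * B $$ (k, l) * Q $$ (l, i))"
    using w(5-7) unfolding w(3)
    by (auto simp: scalar_prod_def atLeast0LessThan sum_distrib_left mult_ac intro!: sum.cong)
  also have "\<dots> = (\<Sum>k<n. \<Sum>i<n. \<Sum>l<n. P $$ (i, k) * B $$ (k, l) * Q $$ (l, i))"
    by (rule sum.swap)
  also have "\<dots> = (\<Sum>k<n. \<Sum>l<n. \<Sum>i<n. P $$ (i, k) * B $$ (k, l) * Q $$ (l, i))"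
    by (rule sum.cong[OF refl], rule sum.swap)
  also have "\<dots> = (\<Sum>k<n. \<Sum>l<n. B $$ (k, l) * (Q * P) $$ (l, k))"
    using w(5-7)
    by (auto simp: scalar_prod_def atLeast0LessThan sum_distrib_left mult_ac intro!: sum.cong)
  also have "\<dots> = (\<Sum>l<n. B $$ (l, l))"
    unfolding w(2) by (intro sum.cong refl) (simp add: if_distrib[of "\<lambda>x. _ * x"] cong: if_cong)
  also have "\<dots> = sum_list rs"
    using diag w(5) by (auto simp: diag_mat_def sum_list_sum_nth atLeast0LessThan)
  finally show "(\<Sum>i<n. A $$ (i, i)) = sum_list rs" .
qed

lemma mult_mat_vec_index_sum:
  assumes "A \<in> carrier_mat n n" "v \<in> carrier_vec n" "u < n"
  shows "(A *\<^sub>v v) $ u = (\<Sum>j<n. A $$ (u, j) * v $ j)"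
  using assms by (auto simp: scalar_prod_def atLeast0LessThan)

text \<open>If \<open>r < n\<close> orthonormal eigenvectors are given, moving all their eigenvalues to \<open>c\<close> yields a
  symmetric matrix with trace different from \<open>n c\<close>, for a suitable \<open>c\<close>. It therefore has an
  eigenvalue other than \<open>c\<close>, whose eigenvectors are orthogonal to the given ones.\<close>

lemma symmetric_orthonormal_eigenvectors_upto:
  fixes A :: "real mat"
  assumes A: "A \<in> carrier_mat n n"
    and sym: "\<And>i j. i < n \<Longrightarrow> j < n \<Longrightarrow> A $$ (i, j) = A $$ (j, i)"
    and "r \<le> n"
  shows "\<exists>l w. (\<forall>i<r. \<forall>j<r. (\<Sum>u<n. w i u * w j u) = (if i = j then 1 else 0)) \<and>
           (\<forall>j<r. \<forall>u<n. (\<Sum>v<n. A $$ (u, v) * w j v) = l j * (w j u :: real))"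
  using \<open>r \<le> n\<close>
proof (induction r)
  case (Suc r)
  then have "r \<le> n" by simp
  from Suc.IH[OF this] obtain l w where
    orth: "\<And>i j. i < r \<Longrightarrow> j < r \<Longrightarrow> (\<Sum>u<n. w i u * w j u) = (if i = j then 1 else 0 :: real)" and
    ev: "\<And>j u. j < r \<Longrightarrow> u < n \<Longrightarrow> (\<Sum>v<n. A $$ (u, v) * w j v) = l j * w j u"
    by blast
  define T where "T = (\<Sum>i<n. A $$ (i, i)) - (\<Sum>j<r. l j)"
  \<comment> \<open>The matrix \<open>B\<close> below has trace \<open>T + r * c\<close>. A spectrum
    consisting of \<open>c\<close> alone would require \<open>T + r * c = n * c\<close>, and this
    choice makes \<open>(n - r) * c = T + 1\<close> instead.\<close>
  define c where "c = (T + 1) / (real n - real r)"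
  have c: "(real n - real r) * c \<noteq> T" using Suc.prems by (simp add: c_def)
  define B where "B = mat n n (\<lambda>(u, v). A $$ (u, v) + (\<Sum>j<r. (c - l j) * w j u * w j v))"
  have B: "B \<in> carrier_mat n n" by (simp add: B_def)
  have Bsym: "B $$ (i, j) = B $$ (j, i)" if "i < n" "j < n" for i j
    using that by (simp add: B_def sym mult_ac)
  have Bact: "(\<Sum>v<n. B $$ (u, v) * f v)
      = (\<Sum>v<n. A $$ (u, v) * f v) + (\<Sum>j<r. (c - l j) * w j u * (\<Sum>v<n. w j v * f v))"
    if "u < n" for u and f :: "nat \<Rightarrow> real"
  proof -
    have "(\<Sum>v<n. B $$ (u, v) * f v)
        = (\<Sum>v<n. A $$ (u, v) * f v) + (\<Sum>v<n. \<Sum>j<r. (c - l j) * w j u * w j v * f v)"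
      using that by (simp add: B_def distrib_right sum.distrib sum_distrib_right)
    also have "(\<Sum>v<n. \<Sum>j<r. (c - l j) * w j u * w j v * f v)
        = (\<Sum>j<r. \<Sum>v<n. (c - l j) * w j u * w j v * f v)"
      by (rule sum.swap)
    finally show ?thesis by (simp add: sum_distrib_left mult_ac)
  qed
  have Bev: "(\<Sum>v<n. B $$ (u, v) * w i v) = c * w i u" if "u < n" "i < r" for u i
  proof -
    have "(\<Sum>j<r. (c - l j) * w j u * (\<Sum>v<n. w j v * w i v))
        = (\<Sum>j<r. if j = i then (c - l j) * w j u else 0)"
      using that by (intro sum.cong refl) (simp add: orth)
    also have "\<dots> = (c - l i) * w i u" using that by simp
    finally show ?thesis
      unfolding Bact[OF that(1)] using that by (simp add: ev left_diff_distrib)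
  qed
  obtain rs where rs: "char_poly B = (\<Prod>r\<leftarrow>rs. [:- r, 1:])"
    using char_poly_splits_symmetric[OF B Bsym] by blast
  have "\<exists>e\<in>set rs. e \<noteq> c"
  proof (rule ccontr)
    assume "\<not> ?thesis"
    then have "rs = replicate (length rs) c"
      by (simp add: replicate_length_same)
    then have "sum_list rs = length rs * c" by (metis sum_list_replicate)
    then have "(\<Sum>i<n. B $$ (i, i)) = n * c"
      using trace_eq_sum_list_roots[OF B rs] by simp
    moreover have "(\<Sum>i<n. B $$ (i, i))
        = (\<Sum>i<n. A $$ (i, i)) + (\<Sum>i<n. \<Sum>j<r. (c - l j) * w j i * w j i)"
      by (simp add: B_def sum.distrib)
    moreover have "(\<Sum>i<n. \<Sum>j<r. (c - l j) * w j i * w j i)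
        = (\<Sum>j<r. (c - l j) * (\<Sum>i<n. w j i * w j i))"
      by (subst sum.swap) (simp add: sum_distrib_left mult_ac)
    moreover have "\<dots> = r * c - (\<Sum>j<r. l j)"
      by (simp add: orth sum_subtractf)
    ultimately show False using c by (simp add: T_def algebra_simps)
  qed
  then obtain e where e: "e \<in> set rs" "e \<noteq> c" by blast
  then have "eigenvalue B e"
    unfolding eigenvalue_root_char_poly[OF B] rs
    by (auto simp: poly_prod_list prod_list_zero_iff image_iff)
  then obtain x where x: "x \<in> carrier_vec n" "x \<noteq> 0\<^sub>v n" "B *\<^sub>v x = e \<cdot>\<^sub>v x"
    using B by (auto simp: eigenvalue_def eigenvector_def)
  have Bx: "(\<Sum>v<n. B $$ (u, v) * x $ v) = e * x $ u" if "u < n" for u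
    using mult_mat_vec_index_sum[OF B x(1) that] x(1,3) that by simp
  \<comment> \<open>Eigenvectors of the symmetric \<open>B\<close> for the distinct eigenvalues
    \<open>e\<close> and \<open>c\<close> are orthogonal.\<close>
  have orthx: "(\<Sum>u<n. w i u * x $ u) = 0" if "i < r" for i
  proof -
    have "e * (\<Sum>u<n. w i u * x $ u) = (\<Sum>u<n. \<Sum>v<n. w i u * (B $$ (u, v) * x $ v))"
      by (simp add: sum_distrib_left[symmetric] Bx) (simp add: sum_distrib_left mult_ac)
    also have "\<dots> = (\<Sum>v<n. \<Sum>u<n. w i u * (B $$ (u, v) * x $ v))"
      by (rule sum.swap)
    also have "\<dots> = (\<Sum>v<n. x $ v * (\<Sum>u<n. B $$ (v, u) * w i u))"
      by (simp add: sum_distrib_left Bsym mult_ac)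
    also have "\<dots> = (\<Sum>v<n. x $ v * (c * w i v))"
      using that by (intro sum.cong refl) (simp add: Bev)
    also have "\<dots> = c * (\<Sum>u<n. w i u * x $ u)"
      by (simp add: sum_distrib_left mult_ac)
    finally show ?thesis using e(2) by simp
  qed
  \<comment> \<open>By this orthogonality the correction added to \<open>A\<close> annihilates
    \<open>x\<close>, so \<open>x\<close> is an eigenvector of \<open>A\<close> itself.\<close>
  have Ax: "(\<Sum>v<n. A $$ (u, v) * x $ v) = e * x $ u" if "u < n" for u
    using Bact[OF that, of "\<lambda>v. x $ v"] Bx[OF that] orthx by simp
  define s where "s = sqrt (\<Sum>u<n. x $ u * x $ u)"
  have "(\<Sum>u<n. x $ u * x $ u) \<noteq> 0"
  proof
    assume "(\<Sum>u<n. x $ u * x $ u) = 0"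
    then have "\<forall>u<n. x $ u = 0" by (simp add: sum_nonneg_eq_0_iff)
    then show False using x(1,2) by (auto intro!: eq_vecI)
  qed
  moreover have "(\<Sum>u<n. x $ u * x $ u) \<ge> 0" by (simp add: sum_nonneg)
  ultimately have s: "s \<noteq> 0" "(\<Sum>u<n. x $ u * x $ u) = s * s" by (auto simp: s_def)
  define w' where "w' = w(r := \<lambda>u. x $ u / s)"
  define l' where "l' = l(r := e)"
  have "(\<Sum>u<n. w' i u * w' j u) = (if i = j then 1 else 0)" if "i < Suc r" "j < Suc r" for i j
    using that s orth orthx
    by (auto simp: w'_def less_Suc_eq mult_ac simp flip: sum_divide_distrib)
  moreover have "(\<Sum>v<n. A $$ (u, v) * w' j v) = l' j * w' j u" if "j < Suc r" "u < n" for j u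
    using that ev Ax by (auto simp: w'_def l'_def less_Suc_eq simp flip: sum_divide_distrib)
  ultimately show ?case by blast
qed simp

text \<open>For \<open>r = n\<close> the orthonormal eigenvectors form a square matrix
  \<open>P\<close>. Its one-sided inverse \<open>Q\<close> is two-sided, which is completeness, and
  the similarity \<open>A = P * D * Q\<close> yields the spectrum with multiplicities.\<close>

theorem spectral_theorem_symmetric:
  fixes A :: "real mat"
  assumes A: "A \<in> carrier_mat n n"
    and "transpose_mat A = A"
  shows "\<exists>l w. (\<forall>i<n. \<forall>j<n. (\<Sum>u<n. w i u * w j u) = (if i = j then 1 else 0)) \<and>
           (\<forall>u<n. \<forall>v<n. (\<Sum>j<n. w j u * w j v) = (if u = v then 1 else 0)) \<and>
           (\<forall>j<n. \<forall>u<n. (\<Sum>v<n. A $$ (u, v) * w j v) = l j * (w j u :: real)) \<and>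
           proots (char_poly A) = image_mset l (mset_set {..<n})"
proof -
  have sym: "A $$ (i, j) = A $$ (j, i)" if "i < n" "j < n" for i j
    using that A assms(2) by (metis carrier_matD index_transpose_mat(1))
  obtain l w where
    orth: "\<And>i j. i < n \<Longrightarrow> j < n \<Longrightarrow> (\<Sum>u<n. w i u * w j u) = (if i = j then 1 else 0 :: real)" and
    ev: "\<And>j u. j < n \<Longrightarrow> u < n \<Longrightarrow> (\<Sum>v<n. A $$ (u, v) * w j v) = l j * w j u"
    using symmetric_orthonormal_eigenvectors_upto[OF A sym order.refl] by blast
  define P where "P = mat n n (\<lambda>(u, j). w j u)"
  define Q where "Q = mat n n (\<lambda>(j, u). w j u)"
  define D where "D = mat n n (\<lambda>(i, j). if i = j then l j else 0)"
  have carr: "P \<in> carrier_mat n n" "Q \<in> carrier_mat n n" "D \<in> carrier_mat n n"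
    by (auto simp: P_def Q_def D_def)
  have QP: "Q * P = 1\<^sub>m n"
    by (rule eq_matI) (auto simp: P_def Q_def scalar_prod_def atLeast0LessThan orth)
  then have PQ: "P * Q = 1\<^sub>m n"
    using mat_mult_left_right_inverse carr by blast
  have complete: "(\<Sum>j<n. w j u * w j v) = (if u = v then 1 else 0)" if "u < n" "v < n" for u v
  proof -
    have "(P * Q) $$ (u, v) = (\<Sum>j<n. w j u * w j v)"
      using that by (auto simp: P_def Q_def scalar_prod_def atLeast0LessThan)
    then show ?thesis using that PQ by simp
  qed
  have "A * P = P * D"
    using A by (intro eq_matI)
      (auto simp: P_def D_def scalar_prod_def atLeast0LessThan ev if_distrib[of "\<lambda>x. _ * x"] cong: if_cong)
  then have "A = P * D * Q"
    using A carr PQ by (metis assoc_mult_mat right_mult_one_mat)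
  then have "char_poly A = char_poly D"
    using A carr PQ QP by (intro char_poly_similar similar_matI[of _ _ P Q n]) auto
  also have "\<dots> = (\<Prod>a\<leftarrow>diag_mat D. [:- a, 1:])"
    by (rule char_poly_upper_triangular[OF carr(3)]) (auto simp: D_def)
  also have "diag_mat D = map l [0..<n]"
    by (auto simp: diag_mat_def D_def)
  finally have "proots (char_poly A) = proots (\<Prod>p\<leftarrow>map (\<lambda>j. [:- l j, 1:]) [0..<n]. p)"
    by (simp add: comp_def)
  also have "\<dots> = (\<Sum>p\<leftarrow>map (\<lambda>j. [:- l j, 1:]) [0..<n]. proots p)"
    by (rule proots_prod_list) auto
  also have "\<dots> = image_mset l (mset_set {..<n})"
    by (induction n) (auto simp: lessThan_Suc)
  finally show ?thesis using orth complete ev by blast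
qed


section \<open>Quadratic forms in an orthonormal eigenbasis\<close>

text \<open>From here on vectors and matrices are functions on a vertex set \<open>X\<close>, so
  that no enumeration of the vertices enters the estimates.\<close>

definition inner_on :: "'a set \<Rightarrow> ('a \<Rightarrow> real) \<Rightarrow> ('a \<Rightarrow> real) \<Rightarrow> real" where
  "inner_on X f g = (\<Sum>u\<in>X. f u * g u)"

definition mat_act :: "'a set \<Rightarrow> ('a \<Rightarrow> 'a \<Rightarrow> real) \<Rightarrow> ('a \<Rightarrow> real) \<Rightarrow> 'a \<Rightarrow> real" where
  "mat_act X M f u = (\<Sum>v\<in>X. M u v * f v)"

definition quad_form :: "'a set \<Rightarrow> ('a \<Rightarrow> 'a \<Rightarrow> real) \<Rightarrow> ('a \<Rightarrow> real) \<Rightarrow> real" where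
  "quad_form X M f = inner_on X f (mat_act X M f)"

text \<open>This is the trace of the product of \<open>M\<close> with the transpose of
  \<open>N\<close>, hence \<open>tr (M N)\<close> for symmetric \<open>N\<close>.\<close>

definition trace_prod :: "'a set \<Rightarrow> ('a \<Rightarrow> 'a \<Rightarrow> real) \<Rightarrow> ('a \<Rightarrow> 'a \<Rightarrow> real) \<Rightarrow> real" where
  "trace_prod X M N = (\<Sum>u\<in>X. \<Sum>v\<in>X. M u v * N u v)"

lemma inner_on_commute: "inner_on X f g = inner_on X g f"
  by (simp add: inner_on_def mult.commute)

lemma inner_on_lin:
  "inner_on X (\<lambda>u. f u + g u) h = inner_on X f h + inner_on X g h"
  "inner_on X (\<lambda>u. f u - g u) h = inner_on X f h - inner_on X g h"
  "inner_on X (\<lambda>u. c * f u) h = c * inner_on X f h"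
  "inner_on X h (\<lambda>u. f u + g u) = inner_on X h f + inner_on X h g"
  "inner_on X h (\<lambda>u. f u - g u) = inner_on X h f - inner_on X h g"
  "inner_on X h (\<lambda>u. c * f u) = c * inner_on X h f"
  by (simp_all add: inner_on_def algebra_simps sum.distrib sum_subtractf sum_distrib_left)

lemma mat_act_lin:
  "mat_act X M (\<lambda>u. f u + g u) = (\<lambda>u. mat_act X M f u + mat_act X M g u)"
  "mat_act X M (\<lambda>u. f u - g u) = (\<lambda>u. mat_act X M f u - mat_act X M g u)"
  "mat_act X M (\<lambda>u. c * f u) = (\<lambda>u. c * mat_act X M f u)"
  by (auto simp: mat_act_def algebra_simps sum.distrib sum_subtractf sum_distrib_left fun_eq_iff)

lemma inner_on_cong:
  "(\<And>u. u \<in> X \<Longrightarrow> f u = f' u) \<Longrightarrow> (\<And>u. u \<in> X \<Longrightarrow> g u = g' u) \<Longrightarrow>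
    inner_on X f g = inner_on X f' g'"
  by (simp add: inner_on_def)

lemma inner_on_ge_0: "inner_on X f f \<ge> 0"
  by (simp add: inner_on_def sum_nonneg)

lemma inner_on_eq_0: "finite X \<Longrightarrow> inner_on X f f = 0 \<Longrightarrow> u \<in> X \<Longrightarrow> f u = 0"
  by (simp add: inner_on_def sum_nonneg_eq_0_iff)

lemma inner_on_mat_act:
  assumes "\<And>u v. u \<in> X \<Longrightarrow> v \<in> X \<Longrightarrow> M u v = M v u"
  shows "inner_on X f (mat_act X M g) = inner_on X (mat_act X M f) g"
proof -
  have "inner_on X f (mat_act X M g) = (\<Sum>u\<in>X. \<Sum>v\<in>X. f u * (M u v * g v))"
    by (simp add: inner_on_def mat_act_def sum_distrib_left)
  also have "\<dots> = (\<Sum>v\<in>X. \<Sum>u\<in>X. f u * (M u v * g v))"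
    by (rule sum.swap)
  also have "\<dots> = inner_on X (mat_act X M f) g"
    unfolding inner_on_def mat_act_def sum_distrib_right
    by (intro sum.cong refl) (simp add: assms mult_ac)
  finally show ?thesis .
qed

lemma quad_form_sum: "quad_form X M f = (\<Sum>u\<in>X. \<Sum>v\<in>X. M u v * (f u * f v))"
  by (simp add: quad_form_def inner_on_def mat_act_def sum_distrib_left mult_ac)

lemma trace_prod_rank_one: "trace_prod X M (\<lambda>u v. f u * f v) = quad_form X M f"
  by (simp add: quad_form_sum trace_prod_def)

lemma trace_prod_lin:
  "trace_prod X M (\<lambda>u v. N u v + N' u v) = trace_prod X M N + trace_prod X M N'"
  "trace_prod X M (\<lambda>u v. N u v - N' u v) = trace_prod X M N - trace_prod X M N'"
  "trace_prod X M (\<lambda>u v. c * N u v) = c * trace_prod X M N"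
  by (simp_all add: trace_prod_def algebra_simps sum.distrib sum_subtractf sum_distrib_left)

lemma quad_form_lin:
  "quad_form X (\<lambda>u v. N u v + N' u v) f = quad_form X N f + quad_form X N' f"
  "quad_form X (\<lambda>u v. N u v - N' u v) f = quad_form X N f - quad_form X N' f"
  "quad_form X (\<lambda>u v. c * N u v) f = c * quad_form X N f"
  by (simp_all add: quad_form_sum algebra_simps sum.distrib sum_subtractf sum_distrib_left)

lemma quad_form_rank_one: "quad_form X (\<lambda>u v. x u * x v) f = (inner_on X x f)\<^sup>2"
  by (simp add: quad_form_sum inner_on_def power2_eq_square sum_product mult_ac)

lemma inner_on_Cauchy_Schwarz: "(inner_on X f g)\<^sup>2 \<le> inner_on X f f * inner_on X g g"
  using Cauchy_Schwarz_ineq_sum[of f g X] by (simp add: inner_on_def power2_eq_square)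

section \<open>Spectral expansions and the Ky Fan bound\<close>

locale eigenbasis =
  fixes X :: "'a set" and a :: "'a \<Rightarrow> 'a \<Rightarrow> real" and n :: nat
    and l :: "nat \<Rightarrow> real" and w :: "nat \<Rightarrow> 'a \<Rightarrow> real"
  assumes finite: "finite X"
    and symm: "u \<in> X \<Longrightarrow> v \<in> X \<Longrightarrow> a u v = a v u"
    and orth: "i < n \<Longrightarrow> j < n \<Longrightarrow> inner_on X (w i) (w j) = (if i = j then 1 else 0)"
    and complete: "u \<in> X \<Longrightarrow> v \<in> X \<Longrightarrow> (\<Sum>j<n. w j u * w j v) = (if u = v then 1 else 0)"
    and eigen: "j < n \<Longrightarrow> u \<in> X \<Longrightarrow> mat_act X a (w j) u = l j * w j u"
begin

lemma expand:
  assumes "u \<in> X"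
  shows "f u = (\<Sum>j<n. inner_on X (w j) f * w j u)"
proof -
  have "(\<Sum>j<n. inner_on X (w j) f * w j u) = (\<Sum>v\<in>X. \<Sum>j<n. w j v * f v * w j u)"
    by (simp add: inner_on_def sum_distrib_right) (rule sum.swap)
  also have "\<dots> = (\<Sum>v\<in>X. f v * (\<Sum>j<n. w j v * w j u))"
    by (simp add: sum_distrib_left mult_ac)
  also have "\<dots> = (\<Sum>v\<in>X. if v = u then f v else 0)"
    using assms by (intro sum.cong refl) (simp add: complete)
  finally show ?thesis using finite assms by simp
qed

lemma inner_on_eigen:
  assumes "j < n"
  shows "inner_on X (w j) (mat_act X a f) = l j * inner_on X (w j) f"
proof -
  have "inner_on X (w j) (mat_act X a f) = inner_on X (\<lambda>u. l j * w j u) f"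
    using assms by (subst inner_on_mat_act[OF symm]) (simp_all add: inner_on_def eigen)
  then show ?thesis by (simp add: inner_on_lin)
qed

lemma mat_act_expand:
  assumes "u \<in> X"
  shows "mat_act X a f u = (\<Sum>j<n. l j * inner_on X (w j) f * w j u)"
  using expand[OF assms, of "mat_act X a f"] by (simp add: inner_on_eigen)

lemma parseval: "inner_on X f g = (\<Sum>j<n. inner_on X (w j) f * inner_on X (w j) g)"
proof -
  have "inner_on X f g = (\<Sum>u\<in>X. \<Sum>j<n. inner_on X (w j) f * w j u * g u)"
    unfolding inner_on_def[of X f g] sum_distrib_right[symmetric]
    by (intro sum.cong refl) (subst expand[of _ f], simp_all)
  also have "\<dots> = (\<Sum>j<n. \<Sum>u\<in>X. inner_on X (w j) f * w j u * g u)"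
    by (rule sum.swap)
  finally show ?thesis by (simp add: inner_on_def[of X _ g] sum_distrib_left mult_ac)
qed

lemma quad_form_expand: "quad_form X a f = (\<Sum>j<n. l j * (inner_on X (w j) f)\<^sup>2)"
  unfolding quad_form_def
  by (subst parseval) (simp add: inner_on_eigen power2_eq_square mult_ac)

lemma entry:
  assumes "u \<in> X" "v \<in> X"
  shows "a u v = (\<Sum>j<n. l j * w j u * w j v)"
proof -
  have "mat_act X a (\<lambda>x. if x = v then 1 else 0) u = a u v"
    using finite assms by (simp add: mat_act_def if_distrib[of "\<lambda>x. _ * x"] cong: if_cong)
  moreover have "inner_on X (w j) (\<lambda>x. if x = v then 1 else 0) = w j v" for j
    using finite assms by (simp add: inner_on_def if_distrib[of "\<lambda>x. _ * x"] cong: if_cong)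
  ultimately show ?thesis
    using mat_act_expand[OF assms(1), of "\<lambda>x. if x = v then 1 else 0"] by (simp add: mult_ac)
qed

lemma trace_prod_expand: "trace_prod X a M = (\<Sum>j<n. l j * quad_form X M (w j))"
proof -
  have "trace_prod X a M = (\<Sum>u\<in>X. \<Sum>v\<in>X. \<Sum>j<n. l j * w j u * w j v * M u v)"
    by (simp add: trace_prod_def entry sum_distrib_right)
  also have "\<dots> = (\<Sum>u\<in>X. \<Sum>j<n. \<Sum>v\<in>X. l j * w j u * w j v * M u v)"
    by (rule sum.cong[OF refl], rule sum.swap)
  also have "\<dots> = (\<Sum>j<n. \<Sum>u\<in>X. \<Sum>v\<in>X. l j * w j u * w j v * M u v)"
    by (rule sum.swap)
  finally show ?thesis by (simp add: quad_form_sum sum_distrib_left mult_ac)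
qed

lemma trace_eq_sum: "(\<Sum>u\<in>X. a u u) = (\<Sum>j<n. l j)"
proof -
  have "(\<Sum>u\<in>X. a u u) = (\<Sum>u\<in>X. \<Sum>j<n. l j * w j u * w j u)"
    by (simp add: entry)
  also have "\<dots> = (\<Sum>j<n. \<Sum>u\<in>X. l j * w j u * w j u)"
    by (rule sum.swap)
  also have "\<dots> = (\<Sum>j<n. l j * inner_on X (w j) (w j))"
    by (simp add: inner_on_def sum_distrib_left mult_ac)
  finally show ?thesis by (simp add: orth)
qed

lemma rayleigh:
  assumes "\<And>j. j < n \<Longrightarrow> l j \<le> r"
  shows "quad_form X a f \<le> r * inner_on X f f"
proof -
  have "quad_form X a f \<le> (\<Sum>j<n. r * (inner_on X (w j) f)\<^sup>2)"
    unfolding quad_form_expand using assms by (intro sum_mono mult_right_mono) auto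
  then show ?thesis
    unfolding parseval[of f f] by (simp add: sum_distrib_left power2_eq_square)
qed

text \<open>The defect in the Rayleigh bound is the sum of the nonnegative terms
  \<open>(r - l j) * (inner_on X (w j) f)\<^sup>2\<close>. If it is zero, \<open>f\<close> has
  components only along eigenvectors with eigenvalue \<open>r\<close>.\<close>

lemma rayleigh_eq:
  assumes r: "\<And>j. j < n \<Longrightarrow> l j \<le> r" and f: "quad_form X a f = r * inner_on X f f"
    and u: "u \<in> X"
  shows "mat_act X a f u = r * f u"
proof -
  have "(\<Sum>j<n. (r - l j) * (inner_on X (w j) f)\<^sup>2) = 0"
    using f unfolding quad_form_expand parseval[of f f]
    by (simp add: left_diff_distrib sum_subtractf sum_distrib_left power2_eq_square)
  then have "\<forall>j\<in>{..<n}. (r - l j) * (inner_on X (w j) f)\<^sup>2 = 0"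
    by (subst (asm) sum_nonneg_eq_0_iff) (auto simp: r)
  then have "l j * inner_on X (w j) f = r * inner_on X (w j) f" if "j < n" for j
    using that by auto
  then have "mat_act X a f u = (\<Sum>j<n. r * inner_on X (w j) f * w j u)"
    unfolding mat_act_expand[OF u] by (intro sum.cong refl) simp
  also have "\<dots> = r * f u"
    using expand[OF u, of f] by (simp add: sum_distrib_left mult_ac)
  finally show ?thesis .
qed

text \<open>Here \<open>\<bar>l j\<bar> + l j\<close> is twice the positive part of
  \<open>l j\<close>, while \<open>M\<close> takes a value in \<open>[0, 1]\<close> at the unit
  vector \<open>w j\<close>. The difference is the slack of one eigenvalue in the Ky Fan
  bound.\<close>

lemma ky_fan_summand:
  assumes "0 \<le> quad_form X M (w j)" "quad_form X M (w j) \<le> inner_on X (w j) (w j)" "j < n"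
  shows "0 \<le> \<bar>l j\<bar> + l j - 2 * (l j * quad_form X M (w j))"
proof (cases "l j \<ge> 0")
  case True
  then show ?thesis using mult_left_mono[OF assms(2) True] orth assms(3) by simp
next
  case False
  then show ?thesis using mult_nonpos_nonneg[of "l j", OF _ assms(1)] by simp
qed

lemma sum_ky_fan_summands:
  assumes "(\<Sum>j<n. l j) = 0"
  shows "(\<Sum>j<n. \<bar>l j\<bar> + l j - 2 * (l j * quad_form X M (w j)))
    = (\<Sum>j<n. \<bar>l j\<bar>) - 2 * trace_prod X a M"
  using assms by (simp add: trace_prod_expand sum.distrib sum_subtractf sum_distrib_left)

lemma ky_fan:
  assumes tr: "(\<Sum>j<n. l j) = 0"
    and M: "\<And>f. 0 \<le> quad_form X M f" "\<And>f. quad_form X M f \<le> inner_on X f f"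
  shows "2 * trace_prod X a M \<le> (\<Sum>j<n. \<bar>l j\<bar>)"
  using sum_nonneg[OF ky_fan_summand[OF M], of "{..<n}" "\<lambda>j. j"] sum_ky_fan_summands[OF tr, of M]
  by simp

text \<open>Equality makes the sum of the nonnegative slacks zero, hence each slack zero, and this
  fixes \<open>M\<close> at every eigenvector with nonzero eigenvalue.\<close>

lemma ky_fan_eq:
  assumes tr: "(\<Sum>j<n. l j) = 0"
    and M: "\<And>f. 0 \<le> quad_form X M f" "\<And>f. quad_form X M f \<le> inner_on X f f"
    and eq: "2 * trace_prod X a M = (\<Sum>j<n. \<bar>l j\<bar>)" and j: "j < n"
  shows "l j > 0 \<Longrightarrow> quad_form X M (w j) = 1" "l j < 0 \<Longrightarrow> quad_form X M (w j) = 0"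
proof -
  have "(\<Sum>j<n. \<bar>l j\<bar> + l j - 2 * (l j * quad_form X M (w j))) = 0"
    using sum_ky_fan_summands[OF tr, of M] eq by simp
  then have "\<bar>l j\<bar> + l j - 2 * (l j * quad_form X M (w j)) = 0"
    using j ky_fan_summand[OF M]
      sum_nonneg_eq_0_iff[of "{..<n}" "\<lambda>j. \<bar>l j\<bar> + l j - 2 * (l j * quad_form X M (w j))"]
    by auto
  then show "l j > 0 \<Longrightarrow> quad_form X M (w j) = 1" "l j < 0 \<Longrightarrow> quad_form X M (w j) = 0"
    by auto
qed

end

section \<open>Eigenbases and Perron vectors of graphs\<close>

definition adjacency :: "'a set set \<Rightarrow> 'a \<Rightarrow> 'a \<Rightarrow> real" where
  "adjacency E u v = (if {u, v} \<in> E then 1 else 0)"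

lemma adjacency_commute: "adjacency E u v = adjacency E v u"
  by (simp add: adjacency_def insert_commute)

text \<open>The enumeration behind \<open>adj_mat\<close> identifies indices with vertices, and its
  inverse \<open>p\<close> carries the matrix eigenvectors over to functions on the vertices. The
  eigenvalues sum to zero because a simple graph has no loops.\<close>

lemma graph_eigenbasis:
  assumes G: "simple_graph G"
  obtains n l w where "eigenbasis (verts G) (adjacency (edges G)) n l w"
    "adj_spectrum G = image_mset l (mset_set {..<n})" "(\<Sum>j<n. l j) = 0"
proof -
  let ?X = "verts G"
  have fin: "finite ?X" using G by (simp add: simple_graph_def)
  obtain xs where xs: "distinct xs" "set xs = ?X" "adj_mat G = adj_mat_of xs (edges G)"
    using adj_mat_eq[OF fin] .
  define n where "n = length xs"
  have A: "adj_mat G \<in> carrier_mat n n" by (simp add: xs(3) adj_mat_of_def n_def)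
  have idx: "adj_mat G $$ (i, j) = adjacency (edges G) (xs ! i) (xs ! j)" if "i < n" "j < n" for i j
    using that by (simp add: xs(3) adj_mat_of_def n_def adjacency_def)
  have "transpose_mat (adj_mat G) = adj_mat G"
    using A by (intro eq_matI) (auto simp: idx adjacency_commute)
  from spectral_theorem_symmetric[OF A this] obtain l w0 where L:
    "\<forall>i<n. \<forall>j<n. (\<Sum>u<n. w0 i u * w0 j u) = (if i = j then 1 else 0)"
    "\<forall>u<n. \<forall>v<n. (\<Sum>j<n. w0 j u * w0 j v) = (if u = v then 1 else 0)"
    "\<forall>j<n. \<forall>u<n. (\<Sum>v<n. adj_mat G $$ (u, v) * w0 j v) = l j * w0 j u"
    and spec: "proots (char_poly (adj_mat G)) = image_mset l (mset_set {..<n})"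
    by blast
  note orth = L(1)[rule_format] and compl = L(2)[rule_format] and ev = L(3)[rule_format]
  have bij: "bij_betw ((!) xs) {..<n} ?X"
    using bij_betw_nth[OF xs(1), of "{..<n}" ?X] xs(2) by (simp add: n_def)
  define p where "p = the_inv_into {..<n} ((!) xs)"
  have p: "p (xs ! i) = i" if "i < n" for i
    unfolding p_def using that bij by (intro the_inv_into_f_f) (auto simp: bij_betw_def)
  have pX: "p u < n \<and> xs ! p u = u" if u: "u \<in> ?X" for u
  proof -
    obtain i where "i < n" "u = xs ! i" using u bij_betw_imp_surj_on[OF bij] by blast
    then show ?thesis by (simp add: p)
  qed
  define w where "w j u = w0 j (p u)" for j u
  have sum_X: "(\<Sum>u\<in>?X. f u) = (\<Sum>i<n. f (xs ! i))" for f :: "'a \<Rightarrow> real"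
    by (rule sum.reindex_bij_betw[OF bij, symmetric])
  have eb: "eigenbasis ?X (adjacency (edges G)) n l w"
  proof
    fix u v assume uv: "u \<in> ?X" "v \<in> ?X"
    show "(\<Sum>j<n. w j u * w j v) = (if u = v then 1 else 0)"
    proof -
      have "p u = p v \<longleftrightarrow> u = v" using pX uv by metis
      then show ?thesis using pX uv by (simp add: w_def compl)
    qed
  next
    fix j u assume j: "j < n" and u: "u \<in> ?X"
    have "mat_act ?X (adjacency (edges G)) (w j) u = (\<Sum>i<n. adj_mat G $$ (p u, i) * w0 j i)"
      unfolding mat_act_def sum_X
      using pX[OF u] by (intro sum.cong refl) (simp add: w_def idx p)
    then show "mat_act ?X (adjacency (edges G)) (w j) u = l j * w j u"
      using ev[OF j] pX[OF u] by (simp add: w_def)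
  qed (use fin in \<open>auto simp: adjacency_commute inner_on_def sum_X w_def p orth\<close>)
  moreover have "adjacency (edges G) u u = 0" for u
    using G by (force simp: simple_graph_def adjacency_def)
  then have "(\<Sum>j<n. l j) = 0"
    using eigenbasis.trace_eq_sum[OF eb] by simp
  ultimately show ?thesis
    using that spec by (simp add: adj_spectrum_def)
qed

lemma graph_energy_spectrum:
  assumes "adj_spectrum G = image_mset l (mset_set {..<n})"
  shows "graph_energy G = (\<Sum>j<n. \<bar>l j\<bar>)"
  by (simp only: graph_energy_def assms multiset.map_comp comp_def sum_unfold_sum_mset)

text \<open>Replacing an eigenvector of the largest eigenvalue by its absolute value keeps the norm
  and cannot decrease the form, as the entries of the matrix are nonnegative. So the absolute value
  attains the Rayleigh bound and is an eigenvector too.\<close>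

lemma graph_perron:
  assumes H: "simple_graph H" and ne: "verts H \<noteq> {}"
  defines "r \<equiv> graph_spectral_radius H"
  obtains h where "\<And>u. h u \<ge> 0" "inner_on (verts H) h h = 1"
    "\<And>u. u \<in> verts H \<Longrightarrow> mat_act (verts H) (adjacency (edges H)) h u = r * h u"
    "\<And>f. quad_form (verts H) (adjacency (edges H)) f \<le> r * inner_on (verts H) f f"
proof -
  let ?X = "verts H" and ?a = "adjacency (edges H)"
  have fin: "finite ?X" using H by (simp add: simple_graph_def)
  obtain n l w where eb: "eigenbasis ?X ?a n l w"
    and spec: "adj_spectrum H = image_mset l (mset_set {..<n})"
    using graph_eigenbasis[OF H] by blast
  interpret eigenbasis ?X ?a n l w by fact
  have ev: "{x. eigenvalue (adj_mat H) x} = l ` {..<n}"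
    using set_adj_spectrum[OF fin] spec by simp
  have r: "r = Max (l ` {..<n})" by (simp add: r_def graph_spectral_radius_def ev)
  have "l ` {..<n} \<noteq> {}" using eigenvalues_finite_nonempty(2)[OF fin ne] ev by simp
  then have "r \<in> l ` {..<n}" unfolding r by (intro Max_in) auto
  then obtain j where j: "j < n" "l j = r" by auto
  have max: "l i \<le> r" if "i < n" for i unfolding r using that by simp
  define h where "h u = \<bar>w j u\<bar>" for u
  have hh: "inner_on ?X h h = 1" using orth[OF j(1) j(1)] by (simp add: h_def inner_on_def)
  have "r = quad_form ?X ?a (w j)"
  proof -
    have "quad_form ?X ?a (w j) = inner_on ?X (w j) (\<lambda>u. r * w j u)"
      unfolding quad_form_def by (intro inner_on_cong) (simp_all add: eigen j)
    then show ?thesis using orth[OF j(1) j(1)] by (simp add: inner_on_lin)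
  qed
  also have "\<dots> \<le> quad_form ?X ?a h"
    unfolding quad_form_sum h_def
    by (intro sum_mono) (auto simp: adjacency_def simp flip: abs_mult)
  finally have "quad_form ?X ?a h = r * inner_on ?X h h"
    using rayleigh[OF max, of h] hh by simp
  then show ?thesis
    using that[of h] rayleigh_eq[OF max] rayleigh[OF max] hh by (auto simp: h_def)
qed


section \<open>Complete multipartite graphs\<close>

lemma quad_form_diff:
  assumes "\<And>u v. u \<in> X \<Longrightarrow> v \<in> X \<Longrightarrow> M u v = M v u"
  shows "quad_form X M (\<lambda>u. f u - g u)
    = quad_form X M f - 2 * inner_on X (mat_act X M f) g + quad_form X M g"
  using inner_on_mat_act[where M = M and X = X and f = g and g = f, OF assms]
    inner_on_commute[of X f "mat_act X M g"] inner_on_commute[of X g "mat_act X M f"]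
  by (simp add: quad_form_def mat_act_lin inner_on_lin)

text \<open>This bounds a form from below by the contribution of a few chosen edges, each counted as
  two ordered pairs.\<close>

lemma quad_form_ge_pairs:
  assumes "finite X" "T \<subseteq> X \<times> X"
    and "\<And>u v. u \<in> X \<Longrightarrow> v \<in> X \<Longrightarrow> 0 \<le> M u v * (f u * f v)"
  shows "(\<Sum>(u, v)\<in>T. M u v * (f u * f v)) \<le> quad_form X M f"
  unfolding quad_form_sum sum.cartesian_product
  using assms by (intro sum_mono2) auto

lemma sum_if_fibre:
  fixes f :: "'a \<Rightarrow> real"
  assumes "finite X"
  shows "(\<Sum>v\<in>X. if p v = i then f v else 0) = sum f {v \<in> X. p v = i}"
  using assms by (simp add: sum.inter_filter)

section \<open>Averaging over the parts and the spectrum of a complete multipartite graph\<close>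

locale partition =
  fixes X :: "'a set" and p :: "'a \<Rightarrow> nat"
  assumes finite_X: "finite X"
begin

definition part :: "'a \<Rightarrow> 'a set" where
  "part u = {v \<in> X. p v = p u}"

definition multipartite :: "'a \<Rightarrow> 'a \<Rightarrow> real" where
  "multipartite u v = (if p u = p v then 0 else 1)"

text \<open>On \<open>X\<close> this is the matrix \<open>K\<close>: the orthogonal projection onto
  the functions that are constant on the parts.\<close>

definition averaging :: "'a \<Rightarrow> 'a \<Rightarrow> real" where
  "averaging u v = (if p u = p v then 1 / card (part u) else 0)"

abbreviation avg :: "('a \<Rightarrow> real) \<Rightarrow> 'a \<Rightarrow> real" where
  "avg \<equiv> mat_act X averaging"

lemma finite_part: "finite (part u)"
  using finite_X by (simp add: part_def)

lemma part_cong: "p u = p v \<Longrightarrow> part u = part v"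
  by (simp add: part_def)

lemma card_part_pos: "u \<in> X \<Longrightarrow> card (part u) > 0"
  using finite_part by (auto simp: part_def card_gt_0_iff)

lemma averaging_commute: "averaging u v = averaging v u"
  using part_cong[of u v] by (simp add: averaging_def)

lemma avg_eq: "avg f u = sum f (part u) / card (part u)"
proof -
  have "avg f u = (\<Sum>v\<in>X. if p v = p u then f v / card (part u) else 0)"
    unfolding mat_act_def averaging_def by (intro sum.cong) auto
  then show ?thesis
    using sum_if_fibre[OF finite_X, of p "p u"] by (simp add: part_def sum_divide_distrib)
qed

lemma avg_cong: "p u = p v \<Longrightarrow> avg f u = avg f v"
  using part_cong[of u v] by (simp add: avg_eq)

lemma avg_const:
  assumes "u \<in> X" and "\<And>v. v \<in> X \<Longrightarrow> p v = p u \<Longrightarrow> f v = f u"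
  shows "avg f u = f u"
proof -
  have "sum f (part u) = (\<Sum>v\<in>part u. f u)"
    by (rule sum.cong) (auto simp: part_def intro: assms(2))
  then show ?thesis using card_part_pos[OF assms(1)] by (simp add: avg_eq)
qed

lemma avg_avg: "u \<in> X \<Longrightarrow> avg (avg f) u = avg f u"
  by (rule avg_const) (auto intro: avg_cong)

lemma inner_on_avg: "inner_on X f (avg g) = inner_on X (avg f) g"
  by (rule inner_on_mat_act) (rule averaging_commute)

lemma inner_on_avg_avg: "inner_on X (avg f) (avg f) = inner_on X f (avg f)"
proof -
  have "inner_on X (avg f) (avg f) = inner_on X f (avg (avg f))"
    by (rule inner_on_avg[symmetric])
  also have "\<dots> = inner_on X f (avg f)"
    by (simp add: inner_on_def avg_avg)
  finally show ?thesis .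
qed

definition centred :: "('a \<Rightarrow> real) \<Rightarrow> 'a \<Rightarrow> real" where
  "centred f u = f u - avg f u"

lemma avg_centred: "u \<in> X \<Longrightarrow> avg (centred f) u = 0"
  unfolding centred_def mat_act_lin by (simp add: avg_avg)

lemma inner_on_centred:
  "inner_on X (centred f) (centred f) = inner_on X f f - inner_on X f (avg f)"
  unfolding centred_def inner_on_lin
  using inner_on_avg_avg[of f] inner_on_commute[of X f "avg f"] by simp

lemma inner_on_const_centred:
  assumes "\<And>u. u \<in> X \<Longrightarrow> avg x u = x u"
  shows "inner_on X x (centred f) = 0"
proof -
  have "inner_on X x (centred f) = inner_on X (avg x) (centred f)"
    using assms by (simp add: inner_on_def)
  also have "\<dots> = inner_on X x (avg (centred f))"
    by (rule inner_on_avg[symmetric])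
  also have "\<dots> = 0"
    by (simp add: inner_on_def avg_centred)
  finally show ?thesis .
qed

lemma mat_act_multipartite: "mat_act X multipartite f u = sum f X - sum f (part u)"
proof -
  have "mat_act X multipartite f u = (\<Sum>v\<in>X. f v - (if p v = p u then f v else 0))"
    unfolding mat_act_def multipartite_def by (intro sum.cong) auto
  then show ?thesis
    using sum_if_fibre[OF finite_X, of p "p u" f] by (simp add: part_def sum_subtractf)
qed

text \<open>A centred function sums to zero over every part, hence over \<open>X\<close>, so the
  multipartite matrix annihilates it.\<close>

lemma quad_form_multipartite_centred: "quad_form X multipartite (centred f) = 0"
proof -
  have "sum (centred f) X = 0"
    using inner_on_const_centred[of "\<lambda>_. 1" f] avg_const[of _ "\<lambda>_. 1"]
    by (simp add: inner_on_def)
  moreover have "sum (centred f) (part u) = 0" if "u \<in> X" for u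
    using avg_centred[OF that, of f] card_part_pos[OF that] by (simp add: avg_eq)
  ultimately show ?thesis
    by (simp add: quad_form_def inner_on_def mat_act_multipartite)
qed

text \<open>The form is the square of the total sum minus the sum of the squares of the part sums,
  and the first square vanishes.\<close>

lemma quad_form_multipartite_le_0:
  assumes "sum f X = 0"
  shows "quad_form X multipartite f \<le> 0"
proof -
  have "quad_form X multipartite f = - (\<Sum>u\<in>X. f u * sum f (part u))"
    using assms by (simp add: quad_form_def inner_on_def mat_act_multipartite sum_negf)
  also have "(\<Sum>u\<in>X. f u * sum f (part u)) = inner_on X f (\<lambda>u. card (part u) * avg f u)"
    unfolding inner_on_def by (intro sum.cong refl) (use card_part_pos in \<open>auto simp: avg_eq\<close>)
  \<comment> \<open>The second argument is constant on the parts, so averaging leaves it unchanged.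
    Moving the self-adjoint average to \<open>f\<close> then produces a sum of squares.\<close>
  also have "\<dots> = inner_on X f (avg (\<lambda>u. card (part u) * avg f u))"
    unfolding inner_on_def
    by (intro sum.cong refl arg_cong2[of _ _ _ _ "(*)"] avg_const[symmetric])
      (metis avg_cong part_cong)+
  also have "\<dots> = (\<Sum>u\<in>X. card (part u) * (avg f u)\<^sup>2)"
    unfolding inner_on_avg by (simp add: inner_on_def power2_eq_square mult_ac)
  also have "- \<dots> \<le> 0"
    by (simp add: sum_nonneg)
  finally show ?thesis .
qed

text \<open>The form of a complete multipartite graph is nonpositive on the hyperplane of vectors with sum
  zero, so two orthonormal eigenvectors cannot both belong to positive eigenvalues.\<close>

lemma multipartite_perron:
  assumes eb: "eigenbasis X multipartite n l w" and tr: "(\<Sum>j<n. l j) = 0"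
    and ne: "u0 \<in> X" "v0 \<in> X" "p u0 \<noteq> p v0"
  shows "\<exists>\<mu> x \<sigma>. \<mu> > 0 \<and> (\<Sum>j<n. \<bar>l j\<bar>) = 2 * \<mu> \<and> inner_on X x x = 1 \<and> \<sigma> \<noteq> 0 \<and>
    (\<forall>u\<in>X. mat_act X multipartite x u = \<mu> * x u) \<and>
    (\<forall>u\<in>X. (\<mu> + card (part u)) * x u = \<sigma>)"
proof -
  interpret eigenbasis X multipartite n l w by (rule eb)
  have "\<exists>i<n. l i > 0"
  proof (rule ccontr)
    assume "\<not> ?thesis"
    then have neg: "\<forall>j\<in>{..<n}. 0 \<le> - l j" by force
    have "(\<Sum>j<n. - l j) = 0" using tr by (simp add: sum_negf)
    then have "\<forall>j<n. l j = 0"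
      using sum_nonneg_eq_0_iff[of "{..<n}" "\<lambda>j. - l j"] neg by auto
    then have "multipartite u0 v0 = 0" using ne by (simp add: entry)
    then show False using ne by (simp add: multipartite_def)
  qed
  then obtain i where i: "i < n" "l i > 0" by blast
  have quad: "quad_form X multipartite (\<lambda>u. c * w i u + d * w j u) = c\<^sup>2 * l i + d\<^sup>2 * l j"
    if j: "j < n" "j \<noteq> i" for c d j
  proof -
    have "quad_form X multipartite (\<lambda>u. c * w i u + d * w j u)
        = inner_on X (\<lambda>u. c * w i u + d * w j u) (\<lambda>u. c * l i * w i u + d * l j * w j u)"
      unfolding quad_form_def mat_act_lin
      using i j by (simp add: inner_on_def eigen mult_ac)
    also have "\<dots> = c\<^sup>2 * l i + d\<^sup>2 * l j"
      unfolding inner_on_lin using i j by (simp add: orth power2_eq_square)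
    finally show ?thesis .
  qed
  define s where "s j = sum (w j) X" for j
  have si: "s i \<noteq> 0"
  proof
    assume "s i = 0"
    then have "quad_form X multipartite (w i) \<le> 0"
      by (intro quad_form_multipartite_le_0) (simp add: s_def)
    moreover have "quad_form X multipartite (w i) = inner_on X (w i) (\<lambda>u. l i * w i u)"
      using i by (simp add: quad_form_def inner_on_def eigen)
    ultimately show False using i orth[of i i] by (simp add: inner_on_lin)
  qed
  have others: "l j \<le> 0" if j: "j < n" "j \<noteq> i" for j
  proof -
    \<comment> \<open>The coefficients are chosen to make the entries of this combination of
      \<open>w i\<close> and \<open>w j\<close> sum to zero.\<close>
    have "sum (\<lambda>u. s j * w i u + (- s i) * w j u) X = 0"
      by (simp add: sum_subtractf sum_distrib_left[symmetric] s_def)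
    from quad_form_multipartite_le_0[OF this]
    have "(s j)\<^sup>2 * l i + (s i)\<^sup>2 * l j \<le> 0" using quad[OF j, of "s j" "- s i"] by simp
    moreover have "(s j)\<^sup>2 * l i \<ge> 0" using i by simp
    ultimately have "(s i)\<^sup>2 * l j \<le> 0" by linarith
    then show ?thesis using si by (simp add: mult_le_0_iff)
  qed
  \<comment> \<open>As the trace is zero, the energy is twice the sum of the positive parts, to
    which only \<open>l i\<close> contributes.\<close>
  have "(\<Sum>j<n. \<bar>l j\<bar>) = (\<Sum>j<n. \<bar>l j\<bar> + l j)"
    using tr by (simp add: sum.distrib)
  also have "\<dots> = (\<Sum>j<n. if j = i then 2 * l j else 0)"
  proof (intro sum.cong refl)
    fix j assume "j \<in> {..<n}"
    then show "\<bar>l j\<bar> + l j = (if j = i then 2 * l j else 0)"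
      using i others[of j] by (cases "j = i") simp_all
  qed
  also have "\<dots> = 2 * l i" using i by simp
  finally have E: "(\<Sum>j<n. \<bar>l j\<bar>) = 2 * l i" .
  have ev: "mat_act X multipartite (w i) u = l i * w i u" if "u \<in> X" for u
    using eigen i that by simp
  \<comment> \<open>Vertices of one part have the same neighbours, so the eigenvalue equation with
    \<open>l i > 0\<close> gives them the same entry.\<close>
  have const: "w i v = w i u" if "u \<in> X" "v \<in> X" "p v = p u" for u v
    using ev[of u] ev[of v] that part_cong[of u v] i by (simp add: mat_act_multipartite)
  \<comment> \<open>This solves the eigenvalue equation explicitly. In particular all entries are
    nonzero and have the sign of \<open>s i\<close>.\<close>
  have "(l i + card (part u)) * w i u = s i" if u: "u \<in> X" for u
  proof -
    have "sum (w i) (part u) = card (part u) * w i u"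
    proof -
      have "sum (w i) (part u) = (\<Sum>v\<in>part u. w i u)"
        by (rule sum.cong) (auto simp: part_def intro: const[OF u])
      then show ?thesis by simp
    qed
    then show ?thesis
      using ev[OF u] by (simp add: mat_act_multipartite s_def algebra_simps)
  qed
  then show ?thesis
    using i E orth[of i i] ev si
    by (intro exI[of _ "l i"] exI[of _ "w i"] exI[of _ "s i"]) simp
qed

end


section \<open>Deleting a sparse subgraph\<close>

lemma quad_form_rank_two:
  "quad_form X (\<lambda>u v. x u * x v + c * (y u * y v)) f
    = (inner_on X x f)\<^sup>2 + c * (inner_on X y f)\<^sup>2"
  unfolding quad_form_lin quad_form_rank_one ..

text \<open>The factor \<open>c\<close> stands for the inverse squared norm of \<open>y\<close>,
  which avoids normalising \<open>y\<close>. Then \<open>g f\<close> is the residue of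
  \<open>f\<close> after orthogonal projection onto the span of \<open>x\<close> and
  \<open>y\<close>.\<close>

lemma
  assumes "inner_on X x x = 1" "inner_on X x y = 0" "c * inner_on X y y = 1"
  defines "g f \<equiv> \<lambda>u. f u - (inner_on X x f * x u + c * inner_on X y f * y u)"
  shows norm_residue_two: "inner_on X (g f) (g f) = inner_on X f f - ((inner_on X x f)\<^sup>2 + c * (inner_on X y f)\<^sup>2)"
    and bessel_two: "(inner_on X x f)\<^sup>2 + c * (inner_on X y f)\<^sup>2 \<le> inner_on X f f"
proof -
  define s t where "s = inner_on X x f" and "t = inner_on X y f"
  have "inner_on X (g f) (g f)
      = inner_on X f f - s\<^sup>2 - 2 * c * t\<^sup>2 + c * t\<^sup>2 * (c * inner_on X y y)"
    unfolding g_def inner_on_lin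
    using assms(1,2) inner_on_commute[of X f x] inner_on_commute[of X f y]
      inner_on_commute[of X y x]
    by (simp add: s_def t_def power2_eq_square algebra_simps)
  then show eq: "inner_on X (g f) (g f)
      = inner_on X f f - ((inner_on X x f)\<^sup>2 + c * (inner_on X y f)\<^sup>2)"
    using assms(3) by (simp add: s_def t_def)
  show "(inner_on X x f)\<^sup>2 + c * (inner_on X y f)\<^sup>2 \<le> inner_on X f f"
    using inner_on_ge_0[of X "g f"] unfolding eq by simp
qed

text \<open>The Ky Fan bound is applied to the projection onto the span of \<open>x\<close> and
  \<open>y\<close>. Equality puts the eigenvectors of positive eigenvalues into this span and makes
  those of negative eigenvalues orthogonal to it, so the span contains the image of
  \<open>x\<close>.\<close>

lemma (in eigenbasis) ky_fan_rank_two: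
  assumes tr: "(\<Sum>j<n. l j) = 0"
    and xy: "inner_on X x x = 1" "inner_on X x y = 0" "c * inner_on X y y = 1" and c: "c > 0"
  shows "2 * (quad_form X a x + c * quad_form X a y) \<le> (\<Sum>j<n. \<bar>l j\<bar>)"
    and "2 * (quad_form X a x + c * quad_form X a y) = (\<Sum>j<n. \<bar>l j\<bar>) \<Longrightarrow>
      \<exists>\<alpha> \<beta>. \<forall>u\<in>X. mat_act X a x u = \<alpha> * x u + \<beta> * y u"
proof -
  let ?M = "\<lambda>u v. x u * x v + c * (y u * y v)"
  have M0: "0 \<le> quad_form X ?M f" for f
    using c by (simp add: quad_form_rank_two)
  have M1: "quad_form X ?M f \<le> inner_on X f f" for f
    unfolding quad_form_rank_two by (rule bessel_two[OF xy])
  have tp: "trace_prod X a ?M = quad_form X a x + c * quad_form X a y"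
    unfolding trace_prod_lin trace_prod_rank_one ..
  show "2 * (quad_form X a x + c * quad_form X a y) \<le> (\<Sum>j<n. \<bar>l j\<bar>)"
    using ky_fan[OF tr M0 M1] tp by simp
  assume "2 * (quad_form X a x + c * quad_form X a y) = (\<Sum>j<n. \<bar>l j\<bar>)"
  then have eq: "2 * trace_prod X a ?M = (\<Sum>j<n. \<bar>l j\<bar>)" using tp by simp
  define \<alpha> where "\<alpha> = (\<Sum>j<n. l j * inner_on X (w j) x * inner_on X x (w j))"
  define \<beta> where "\<beta> = (\<Sum>j<n. l j * inner_on X (w j) x * (c * inner_on X y (w j)))"
  have "mat_act X a x u = \<alpha> * x u + \<beta> * y u" if u: "u \<in> X" for u
  proof -
    \<comment> \<open>In the expansion of the image of \<open>x\<close>, each \<open>w j\<close> may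
      be replaced by its projection: it equals its projection if \<open>l j > 0\<close>, and its
      coefficient is zero if \<open>l j \<le> 0\<close>.\<close>
    have "l j * inner_on X (w j) x * w j u
        = l j * inner_on X (w j) x * (inner_on X x (w j) * x u + c * inner_on X y (w j) * y u)"
      if j: "j < n" for j
    proof (cases "l j > 0")
      case True
      then have "quad_form X ?M (w j) = inner_on X (w j) (w j)"
        using ky_fan_eq(1)[OF tr M0 M1 eq j] orth[OF j j] by simp
      moreover define g where
        "g = (\<lambda>u. w j u - (inner_on X x (w j) * x u + c * inner_on X y (w j) * y u))"
      ultimately have "inner_on X g g = 0"
        using norm_residue_two[OF xy, of "w j"] unfolding quad_form_rank_two by simp
      then have "g u = 0"
        by (rule inner_on_eq_0[OF finite _ u])
      then show ?thesis by (simp add: g_def)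
    next
      case False
      show ?thesis
      proof (cases "l j = 0")
        case False
        with \<open>\<not> l j > 0\<close> have "quad_form X ?M (w j) = 0"
          using ky_fan_eq(2)[OF tr M0 M1 eq j] by simp
        then have "inner_on X x (w j) = 0"
          using c unfolding quad_form_rank_two by (simp add: add_nonneg_eq_0_iff)
        then show ?thesis by (simp add: inner_on_commute[of X "w j"])
      qed simp
    qed
    then have "mat_act X a x u = (\<Sum>j<n. l j * inner_on X (w j) x *
        (inner_on X x (w j) * x u + c * inner_on X y (w j) * y u))"
      unfolding mat_act_expand[OF u] by (intro sum.cong refl) simp
    then show ?thesis
      by (simp add: \<alpha>_def \<beta>_def distrib_left sum.distrib sum_distrib_right mult.assoc)
  qed
  then show "\<exists>\<alpha> \<beta>. \<forall>u\<in>X. mat_act X a x u = \<alpha> * x u + \<beta> * y u" by blast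
qed

text \<open>In the application \<open>b\<close> is the adjacency matrix of \<open>H\<close>,
  \<open>Y\<close> its vertex set and \<open>r\<close> its spectral radius. The pair
  \<open>\<mu>\<close>, \<open>x\<close> is the positive eigenvalue of \<open>G\<close> with its
  unit eigenvector, and \<open>l\<close>, \<open>w\<close> diagonalise \<open>G - S\<close>.\<close>

locale sparse_deletion = partition X p for X :: "'a set" and p +
  fixes b :: "'a \<Rightarrow> 'a \<Rightarrow> real" and Y :: "'a set" and r \<mu> \<sigma> :: real and x :: "'a \<Rightarrow> real"
    and n :: nat and l :: "nat \<Rightarrow> real" and w :: "nat \<Rightarrow> 'a \<Rightarrow> real"
  assumes Y: "Y \<subseteq> X"
    and b_cases: "b u v = 0 \<or> b u v = 1"
    and b_commute: "b u v = b v u"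
    and b_supp: "b u v = 1 \<Longrightarrow> u \<in> Y \<and> v \<in> Y \<and> p u \<noteq> p v"
    and rayleigh_b: "quad_form Y b f \<le> r * inner_on Y f f"
    and sparse: "u \<in> X \<Longrightarrow> 2 * r * card (Y \<inter> part u) \<le> card (part u)"
    and r_pos: "r > 0"
    and \<mu>: "\<mu> > 0"
    and x_unit: "inner_on X x x = 1"
    and x_eigen: "u \<in> X \<Longrightarrow> mat_act X multipartite x u = \<mu> * x u"
    and \<sigma>: "\<sigma> \<noteq> 0"
    and x_value: "u \<in> X \<Longrightarrow> (\<mu> + card (part u)) * x u = \<sigma>"
    and eb: "eigenbasis X (\<lambda>u v. multipartite u v - b u v) n l w"
    and tr: "(\<Sum>j<n. l j) = 0"
begin

interpretation eigenbasis X "\<lambda>u v. multipartite u v - b u v" n l w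
  by (rule eb)

lemma finite_Y: "finite Y"
  using Y finite_X finite_subset by blast

lemma avg_x:
  assumes "u \<in> X"
  shows "avg x u = x u"
proof (rule avg_const[OF assms])
  fix v assume v: "v \<in> X" "p v = p u"
  then have "(\<mu> + card (part u)) * x v = (\<mu> + card (part u)) * x u"
    using x_value[OF v(1)] x_value[OF assms] part_cong[of v u] by simp
  then show "x v = x u" using \<mu> by simp
qed

lemma quad_form_x: "quad_form X multipartite x = \<mu>"
proof -
  have "quad_form X multipartite x = inner_on X x (\<lambda>u. \<mu> * x u)"
    by (simp add: quad_form_def inner_on_def x_eigen)
  then show ?thesis by (simp add: inner_on_lin x_unit)
qed

lemma b_outside: "u \<notin> Y \<or> v \<notin> Y \<Longrightarrow> b u v = 0"
  using b_cases[of u v] b_supp[of u v] by auto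

lemma quad_form_b: "quad_form X b f = quad_form Y b f"
proof -
  have "(\<Sum>v\<in>X. b u v * (f u * f v)) = (\<Sum>v\<in>Y. b u v * (f u * f v))" for u
    by (rule sum.mono_neutral_right[OF finite_X Y]) (auto simp: b_outside)
  then have "quad_form X b f = (\<Sum>u\<in>X. \<Sum>v\<in>Y. b u v * (f u * f v))"
    by (simp add: quad_form_sum)
  also have "\<dots> = (\<Sum>u\<in>Y. \<Sum>v\<in>Y. b u v * (f u * f v))"
    by (rule sum.mono_neutral_right[OF finite_X Y]) (auto simp: b_outside)
  finally show ?thesis by (simp add: quad_form_sum)
qed

text \<open>The sum is the fraction of the part of \<open>v\<close> that lies in \<open>Y\<close>,
  which the size condition bounds.\<close>

lemma averaging_column:
  assumes v: "v \<in> X"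
  shows "(\<Sum>u\<in>Y. averaging u v) \<le> 1 / (2 * r)"
proof -
  have "(\<Sum>u\<in>Y. averaging u v) = (\<Sum>u\<in>Y. if p u = p v then 1 / card (part v) else 0)"
    unfolding averaging_def by (intro sum.cong) (auto dest: part_cong)
  also have "\<dots> = card {u \<in> Y. p u = p v} / card (part v)"
    using sum_if_fibre[OF finite_Y, of p "p v" "\<lambda>_. 1 / card (part v)"] by simp
  also have "{u \<in> Y. p u = p v} = Y \<inter> part v"
    using Y by (auto simp: part_def)
  also have "card (Y \<inter> part v) / card (part v) \<le> 1 / (2 * r)"
    using sparse[OF v] r_pos card_part_pos[OF v] by (simp add: field_simps)
  finally show ?thesis .
qed

lemma averaging_weight:
  assumes "Z \<subseteq> X" "\<And>v. g v \<ge> 0"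
  shows "(\<Sum>u\<in>Y. \<Sum>v\<in>Z. averaging u v * g v) \<le> sum g Z / (2 * r)"
proof -
  have "(\<Sum>u\<in>Y. \<Sum>v\<in>Z. averaging u v * g v) = (\<Sum>v\<in>Z. (\<Sum>u\<in>Y. averaging u v) * g v)"
    unfolding sum_distrib_right by (rule sum.swap)
  also have "\<dots> \<le> (\<Sum>v\<in>Z. 1 / (2 * r) * g v)"
    using assms by (intro sum_mono mult_right_mono averaging_column) auto
  finally show ?thesis by (simp add: sum_divide_distrib)
qed

text \<open>Since \<open>x\<close> is constant on the parts, at most the fraction
  \<open>1 / (2 * r)\<close> of its squared norm lies on \<open>Y\<close>, and the Rayleigh bound
  for \<open>b\<close> multiplies this by \<open>r\<close>.\<close>

lemma quad_form_b_x: "quad_form X b x \<le> 1 / 2"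
proof -
  have "quad_form X b x \<le> r * inner_on Y x x"
    unfolding quad_form_b by (rule rayleigh_b)
  also have "inner_on Y x x = (\<Sum>u\<in>Y. avg (\<lambda>v. x v * x v) u)"
    unfolding inner_on_def
  proof (intro sum.cong refl)
    fix u assume u: "u \<in> Y"
    have "x v = x u" if "v \<in> X" "p v = p u" for v
      using avg_x[of u] avg_x[of v] avg_cong[of v u x] that u Y by auto
    then show "x u * x u = avg (\<lambda>v. x v * x v) u"
      using u Y by (intro avg_const[symmetric]) auto
  qed
  also have "\<dots> \<le> inner_on X x x / (2 * r)"
    unfolding mat_act_def inner_on_def by (rule averaging_weight) auto
  finally show ?thesis
    using r_pos by (simp add: x_unit mult_left_mono)
qed

text \<open>This is a Schur test: the arithmetic-geometric mean inequality splits
  \<open>h u * h v\<close> into squares, and each square is weighted by a column sum of the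
  averaging matrix over \<open>Y\<close>.\<close>

lemma avg_form_le:
  assumes "\<And>u. u \<notin> Y \<Longrightarrow> h u = 0"
  shows "inner_on X h (avg h) \<le> inner_on X h h / (2 * r)"
proof -
  have "inner_on X h (avg h) = (\<Sum>u\<in>X. \<Sum>v\<in>X. averaging u v * (h u * h v))"
    by (simp add: quad_form_def[symmetric] quad_form_sum)
  also have "\<dots> = (\<Sum>u\<in>X. \<Sum>v\<in>Y. averaging u v * (h u * h v))"
    by (intro sum.cong refl sum.mono_neutral_right[OF finite_X Y]) (auto simp: assms)
  also have "\<dots> = (\<Sum>u\<in>Y. \<Sum>v\<in>Y. averaging u v * (h u * h v))"
    by (rule sum.mono_neutral_right[OF finite_X Y]) (auto simp: assms)
  also have "\<dots> \<le> (\<Sum>u\<in>Y. \<Sum>v\<in>Y. averaging u v * ((h u)\<^sup>2 / 2 + (h v)\<^sup>2 / 2))"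
  proof (intro sum_mono mult_left_mono)
    show "h u * h v \<le> (h u)\<^sup>2 / 2 + (h v)\<^sup>2 / 2" for u v
      using sum_squares_bound[of "h u" "h v"] by simp
  qed (simp add: averaging_def)
  also have "\<dots> = (\<Sum>u\<in>Y. \<Sum>v\<in>Y. averaging u v * ((h u)\<^sup>2 / 2))
      + (\<Sum>u\<in>Y. \<Sum>v\<in>Y. averaging u v * ((h v)\<^sup>2 / 2))"
    by (simp add: distrib_left sum.distrib)
  also have "(\<Sum>u\<in>Y. \<Sum>v\<in>Y. averaging u v * ((h u)\<^sup>2 / 2))
      = (\<Sum>u\<in>Y. \<Sum>v\<in>Y. averaging u v * ((h v)\<^sup>2 / 2))"
    by (subst sum.swap) (simp add: averaging_commute)
  also have "(\<Sum>u\<in>Y. \<Sum>v\<in>Y. averaging u v * ((h v)\<^sup>2 / 2)) \<le> (\<Sum>v\<in>Y. (h v)\<^sup>2 / 2) / (2 * r)"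
    by (rule averaging_weight[OF Y]) simp
  also have "(\<Sum>v\<in>Y. (h v)\<^sup>2 / 2) = inner_on X h h / 2"
    unfolding inner_on_def sum_divide_distrib
    by (rule sum.mono_neutral_cong_left[OF finite_X Y]) (auto simp: assms power2_eq_square)
  finally show ?thesis by simp
qed

lemma avg_form_ge_0: "0 \<le> inner_on X f (avg f)"
  using inner_on_ge_0[of X "avg f"] by (simp add: inner_on_avg_avg)

text \<open>It serves both cases: \<open>c = r\<close> for the Perron vector of \<open>H\<close>,
  and \<open>c = - 1\<close> for the difference of the endpoints of an isolated edge.\<close>

lemma quad_form_b_centred:
  assumes "\<And>u. u \<in> X \<Longrightarrow> mat_act X b h u = c * h u"
  shows "quad_form X b (centred h)
    = c * inner_on X h h - 2 * c * inner_on X h (avg h) + quad_form X b (avg h)"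
proof -
  have "quad_form X b h = inner_on X h (\<lambda>u. c * h u)"
    by (simp add: quad_form_def inner_on_def assms)
  moreover have "inner_on X (mat_act X b h) (avg h) = inner_on X (\<lambda>u. c * h u) (avg h)"
    by (simp add: inner_on_def assms)
  ultimately show ?thesis
    using quad_form_diff[of X b h "avg h", OF b_commute]
    by (simp add: centred_def[abs_def] inner_on_lin)
qed

lemma energy_gt_dense:
  assumes r: "r \<ge> 4 / 3" and h: "\<And>u. h u \<ge> 0" "\<And>u. u \<notin> Y \<Longrightarrow> h u = 0" "inner_on X h h = 1"
    and hb: "\<And>u. u \<in> X \<Longrightarrow> mat_act X b h u = r * h u"
  shows "2 * \<mu> < (\<Sum>j<n. \<bar>l j\<bar>)"
proof -
  define z where "z = centred h"
  define e where "e = inner_on X h (avg h)"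
  define nz where "nz = inner_on X z z"
  let ?A = "\<lambda>u v. multipartite u v - b u v"
  let ?N = "\<lambda>u v. (if u = v then 1 else 0) - averaging u v"
  let ?M = "\<lambda>u v. x u * x v + ?N u v - 1 / nz * (z u * z v)"
  have e: "0 \<le> e" "e \<le> 1 / (2 * r)"
    using avg_form_ge_0[of h] avg_form_le[of h] h(2,3) by (auto simp: e_def)
  have nz: "nz = 1 - e" by (simp add: nz_def z_def inner_on_centred h e_def)
  have re: "r * e \<le> 1 / 2" using e(2) r by (simp add: field_simps)
  have "1 / (2 * r) < 1" using r by simp
  then have nz_pos: "nz > 0" using e nz by linarith
  have "quad_form X b (avg h) \<ge> 0"
    unfolding quad_form_sum avg_eq using h(1) b_cases
    by (intro sum_nonneg mult_nonneg_nonneg divide_nonneg_nonneg)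
      (auto, metis order.refl zero_le_one)
  then have qz: "quad_form X b z \<ge> r - 2 * (r * e)"
    using quad_form_b_centred[OF hb] by (simp add: z_def e_def h)
  \<comment> \<open>The target \<open>r - 2 * (r * e) - nz / 2\<close> is multiplied by
    \<open>r\<close> so that \<open>r * e \<le> 1 / 2\<close> applies. The result is at least
    \<open>r\<^sup>2 - 3 * r / 2 + 1 / 4\<close>, which exceeds the product
    \<open>(r - 4 / 3) * (r - 1 / 6)\<close> by \<open>1 / 36\<close>.\<close>
  have "(r * e) * (2 * r - 1 / 2) \<le> 1 / 2 * (2 * r - 1 / 2)"
    using re r by (intro mult_right_mono) auto
  moreover have "0 \<le> (r - 4 / 3) * (r - 1 / 6)" using r by (intro mult_nonneg_nonneg) auto
  ultimately have "0 < r * (r - 2 * (r * e) - nz / 2)"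
    unfolding nz by (simp add: algebra_simps) argo
  then have "0 < r - 2 * (r * e) - nz / 2" using r_pos by (simp add: zero_less_mult_iff)
  then have gain: "quad_form X b z / nz > 1 / 2"
    using qz nz_pos by (simp add: field_simps)
  \<comment> \<open>The two matrices have disjoint supports: \<open>?A\<close> vanishes inside the
    parts and \<open>?N\<close> between different parts.\<close>
  have "trace_prod X ?A ?N = 0"
    unfolding trace_prod_def
  proof (intro sum.neutral ballI)
    fix u v
    show "?A u v * ?N u v = 0"
      using b_cases[of u v] b_supp[of u v]
      by (cases "p u = p v") (auto simp: multipartite_def averaging_def)
  qed
  then have "trace_prod X ?A ?M = quad_form X ?A x - 1 / nz * quad_form X ?A z"
    unfolding trace_prod_lin(1,2)[of X ?A] trace_prod_lin(3)[of X ?A] trace_prod_rank_one by simp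
  also have "\<dots> = \<mu> - quad_form X b x + quad_form X b z / nz"
    unfolding quad_form_lin using quad_form_x quad_form_multipartite_centred
    by (simp add: z_def)
  finally have tp: "trace_prod X ?A ?M > \<mu>"
    using gain quad_form_b_x by linarith
  have N: "quad_form X ?N f = inner_on X f f - inner_on X f (avg f)" for f
  proof -
    have "quad_form X (\<lambda>u v. if u = v then 1 else 0) f = inner_on X f f"
      unfolding quad_form_sum inner_on_def using finite_X
      by (intro sum.cong refl) (simp add: if_distrib[of "\<lambda>x. x * _"] cong: if_cong)
    then show ?thesis by (simp add: quad_form_lin quad_form_def)
  qed
  have M: "quad_form X ?M f = (inner_on X x f)\<^sup>2
      + (inner_on X f f - inner_on X f (avg f)) - (inner_on X z f)\<^sup>2 / nz" for f
    unfolding quad_form_lin(1,2)[where N' = "\<lambda>u v. 1 / nz * (z u * z v)"]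
      quad_form_lin(1)[where N' = ?N] N quad_form_lin(3) quad_form_rank_one by simp
  \<comment> \<open>As \<open>z\<close> is orthogonal to the range of \<open>K\<close>, only the
    centred part of \<open>f\<close> pairs with it, and Cauchy-Schwarz bounds the subtracted
    term.\<close>
  have "0 \<le> quad_form X ?M f" for f
  proof -
    have "inner_on X z f = inner_on X z (centred f)"
      using avg_centred[of _ h] inner_on_avg[of z f]
      by (simp add: centred_def[of f, abs_def] inner_on_lin z_def inner_on_def)
    then have "(inner_on X z f)\<^sup>2 \<le> nz * (inner_on X f f - inner_on X f (avg f))"
      using inner_on_Cauchy_Schwarz[of X z "centred f"] by (simp add: nz_def inner_on_centred)
    then have "(inner_on X z f)\<^sup>2 / nz \<le> inner_on X f f - inner_on X f (avg f)"
      using nz_pos by (simp add: field_simps)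
    then show ?thesis unfolding M using zero_le_power2[of "inner_on X x f"] by linarith
  qed
  \<comment> \<open>As \<open>x\<close> lies in the range of \<open>K\<close>, the added term is at
    most the form of \<open>K\<close>, which \<open>?N\<close> has removed.\<close>
  moreover have "quad_form X ?M f \<le> inner_on X f f" for f
  proof -
    have "inner_on X x f = inner_on X x (avg f)"
      using inner_on_avg[of x f] by (simp add: inner_on_def avg_x)
    then have "(inner_on X x f)\<^sup>2 \<le> inner_on X f (avg f)"
      using inner_on_Cauchy_Schwarz[of X x "avg f"] by (simp add: x_unit inner_on_avg_avg)
    moreover have "0 \<le> (inner_on X z f)\<^sup>2 / nz" using nz_pos by simp
    ultimately show ?thesis unfolding M by linarith
  qed
  ultimately have "2 * trace_prod X ?A ?M \<le> (\<Sum>j<n. \<bar>l j\<bar>)" by (rule ky_fan[OF tr])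
  then show ?thesis using tp by linarith
qed

lemma energy_gt_matching:
  assumes r: "r \<ge> 1" and ad: "b a d = 1"
    and matching: "\<And>u v v'. b u v = 1 \<Longrightarrow> b u v' = 1 \<Longrightarrow> v = v'"
  shows "2 * \<mu> < (\<Sum>j<n. \<bar>l j\<bar>)"
proof -
  let ?A = "\<lambda>u v. multipartite u v - b u v"
  define g where "g u = (if u = a then 1 else 0) - (if u = d then 1 else 0 :: real)" for u
  define y where "y = centred g"
  define \<alpha> \<beta> where "\<alpha> = 1 / real (card (part a))" and "\<beta> = 1 / real (card (part d))"
  have da: "b d a = 1" using ad b_commute by metis
  note adY = b_supp[OF ad]
  then have adX: "a \<in> X" "d \<in> X" and pad: "p a \<noteq> p d" "a \<noteq> d" using Y by auto
  \<comment> \<open>Because \<open>r \<ge> 1\<close>, at most half of a part that meets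
    \<open>Y\<close> lies in \<open>Y\<close>. Such a part has at least two vertices, and one of
    them is outside \<open>Y\<close>.\<close>
  have half: "1 / real (card (part u)) \<le> 1 / 2" "\<exists>v\<in>X - Y. p v = p u" if "u \<in> Y" for u
  proof -
    have uX: "u \<in> X" using that Y by auto
    have fin: "finite (Y \<inter> part u)" using finite_part by simp
    have "u \<in> Y \<inter> part u" using that uX by (simp add: part_def)
    then have ge: "card (Y \<inter> part u) \<ge> 1" using fin by (metis One_nat_def Suc_leI card_gt_0_iff empty_iff)
    have "2 * real (card (Y \<inter> part u)) \<le> 2 * r * card (Y \<inter> part u)"
      using r by (intro mult_right_mono) auto
    then have le: "2 * card (Y \<inter> part u) \<le> card (part u)" using sparse[OF uX] by linarith
    then show "1 / real (card (part u)) \<le> 1 / 2" using ge by (simp add: field_simps)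
    have "Y \<inter> part u \<noteq> part u" using ge le by auto
    then show "\<exists>v\<in>X - Y. p v = p u" by (auto simp: part_def)
  qed
  have ab: "0 < \<alpha>" "\<alpha> \<le> 1 / 2" "0 < \<beta>" "\<beta> \<le> 1 / 2"
    using half(1)[of a] half(1)[of d] adY card_part_pos[OF adX(1)] card_part_pos[OF adX(2)]
    unfolding \<alpha>_def \<beta>_def by simp_all
  have sum_g: "(\<Sum>v\<in>Z. g v * f v) = (if a \<in> Z then f a else 0) - (if d \<in> Z then f d else 0)"
    if "finite Z" for Z and f :: "'a \<Rightarrow> real"
    using that by (simp add: g_def left_diff_distrib sum_subtractf if_distrib[of "\<lambda>x. x * _"] cong: if_cong)
  have avg_g: "avg g u = (if p u = p a then \<alpha> else 0) - (if p u = p d then \<beta> else 0)" for u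
    using sum_g[OF finite_part, of "\<lambda>_. 1" u] adX part_cong[of u a] part_cong[of u d]
    by (auto simp: avg_eq part_def \<alpha>_def \<beta>_def diff_divide_distrib)
  have gg: "inner_on X g g = 2" and gag: "inner_on X g (avg g) = \<alpha> + \<beta>"
    using sum_g[OF finite_X] adX pad by (auto simp: inner_on_def avg_g) (auto simp: g_def)
  have b_row: "b u v = (if v = v' then 1 else 0)" if "b u v' = 1" for u v v'
  proof (cases "v = v'")
    case False
    then have "b u v \<noteq> 1" using matching[OF that, of v] by blast
    then show ?thesis using b_cases[of u v] False by simp
  qed (use that in simp)
  \<comment> \<open>In a matching \<open>b\<close> exchanges \<open>a\<close> and \<open>d\<close>,
    so \<open>g\<close> is an eigenvector for \<open>- 1\<close>.\<close>
  have bg: "mat_act X b g u = - 1 * g u" for u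
  proof -
    have "mat_act X b g u = b u a - b u d"
      using sum_g[OF finite_X, of "b u"] adX by (simp add: mat_act_def mult.commute)
    moreover have "b u a = (if u = d then 1 else 0)"
      using b_row[OF ad, of u] by (simp add: b_commute[of u])
    moreover have "b u d = (if u = a then 1 else 0)"
      using b_row[OF da, of u] by (simp add: b_commute[of u])
    ultimately show ?thesis by (simp add: g_def)
  qed
  \<comment> \<open>The average of \<open>g\<close> is \<open>\<alpha>\<close> on the part of
    \<open>a\<close>, \<open>- \<beta>\<close> on the part of \<open>d\<close> and zero elsewhere.
    Edges join different parts, so none contributes negatively, and the edge \<open>ad\<close> alone
    gives \<open>2 * (\<alpha> * \<beta>)\<close>.\<close>
  have "quad_form X (\<lambda>u v. - b u v) (avg g)
      \<ge> (\<Sum>(u, v)\<in>{(a, d), (d, a)}. - b u v * (avg g u * avg g v))"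
  proof (rule quad_form_ge_pairs[OF finite_X])
    show "{(a, d), (d, a)} \<subseteq> X \<times> X" using adX by auto
    show "0 \<le> - b u v * (avg g u * avg g v)" for u v
      using b_cases[of u v] b_supp[of u v] ab pad by (auto simp: avg_g)
  qed
  moreover have "quad_form X (\<lambda>u v. - b u v) (avg g) = - quad_form X b (avg g)"
    by (simp add: quad_form_sum sum_negf)
  ultimately have "quad_form X b (avg g) \<le> - (2 * (\<alpha> * \<beta>))"
    using ad da pad by (simp add: avg_g)
  then have qy: "- quad_form X b y \<ge> 2 * ((1 - \<alpha>) * (1 - \<beta>))"
    using quad_form_b_centred[OF bg] by (simp add: y_def gg gag algebra_simps)
  define ny where "ny = (1 - \<alpha>) + (1 - \<beta>)"
  have ny: "inner_on X y y = ny" "ny > 0"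
    using ab by (simp_all add: y_def inner_on_centred gg gag ny_def)
  \<comment> \<open>The right-hand side equals
    \<open>2 * ((1 - \<alpha>) * (1 - \<beta>)) - ny / 2\<close>.\<close>
  have "0 \<le> (1 - \<alpha>) * (1 / 2 - \<beta>) + (1 - \<beta>) * (1 / 2 - \<alpha>)"
    using ab by (intro add_nonneg_nonneg mult_nonneg_nonneg) auto
  then have "- quad_form X b y \<ge> ny / 2"
    using qy by (simp add: ny_def algebra_simps) argo
  then have gain: "1 / ny * - quad_form X b y \<ge> 1 / 2"
    using ny(2) by (simp add: field_simps)
  have Ax: "quad_form X ?A x = \<mu> - quad_form X b x"
    and Ay: "quad_form X ?A y = - quad_form X b y"
    unfolding quad_form_lin quad_form_x y_def quad_form_multipartite_centred by simp_all
  have xy: "inner_on X x y = 0"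
    unfolding y_def by (rule inner_on_const_centred[OF avg_x])
  have c: "1 / ny * inner_on X y y = 1" "1 / ny > 0" using ny by auto
  note kf = ky_fan_rank_two[OF tr x_unit xy c]
  have ge: "2 * \<mu> \<le> 2 * (quad_form X ?A x + 1 / ny * quad_form X ?A y)"
    unfolding Ax Ay using order_trans[OF quad_form_b_x gain] by (simp add: field_simps)
  show ?thesis
  proof (rule ccontr)
    assume "\<not> ?thesis"
    then have "2 * (quad_form X ?A x + 1 / ny * quad_form X ?A y) = (\<Sum>j<n. \<bar>l j\<bar>)"
      using ge kf(1) by linarith
    from kf(2)[OF this] obtain s t where
      st: "\<And>u. u \<in> X \<Longrightarrow> mat_act X ?A x u = s * x u + t * y u" by blast
    have Aact: "mat_act X ?A x u = \<mu> * x u - mat_act X b x u" if "u \<in> X" for u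
      using x_eigen[OF that] by (simp add: mat_act_def left_diff_distrib sum_subtractf)
    \<comment> \<open>Outside \<open>Y\<close> both \<open>g\<close> and the image of
      \<open>x\<close> under \<open>b\<close> vanish, which leaves a relation between
      \<open>x\<close> and the average of \<open>g\<close>.\<close>
    have out: "(\<mu> - s) * x u = - t * avg g u" if "u \<in> X" "u \<notin> Y" for u
    proof -
      have "mat_act X b x u = 0" using that by (simp add: mat_act_def b_outside)
      moreover have "g u = 0" using that adY by (auto simp: g_def)
      ultimately show ?thesis
        using st[OF that(1)] Aact[OF that(1)] by (simp add: y_def centred_def algebra_simps)
    qed
    have xv: "x u = \<sigma> / (\<mu> + card (part u))" if "u \<in> X" for u
      using x_value[OF that] \<mu> by (simp add: field_simps add_pos_nonneg)
    \<comment> \<open>Both sides of this relation are constant on the parts, so vertices outside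
      \<open>Y\<close> in the parts of \<open>a\<close> and \<open>d\<close> transfer it to
      \<open>a\<close> and \<open>d\<close>.\<close>
    obtain a' where a': "a' \<in> X" "a' \<notin> Y" "p a' = p a" using half(2) adY by blast
    obtain d' where d': "d' \<in> X" "d' \<notin> Y" "p d' = p d" using half(2) adY by blast
    have xa: "x a' = x a" and xd: "x d' = x d"
      using a' d' adX avg_x avg_cong by metis+
    have ea: "(\<mu> - s) * x a = - t * \<alpha>"
      using out[OF a'(1,2)] pad by (simp add: avg_g a' xa)
    have ed: "(\<mu> - s) * x d = t * \<beta>"
      using out[OF d'(1,2)] pad by (simp add: avg_g d' xd)
    \<comment> \<open>This eliminates \<open>t\<close>. The entries of \<open>x\<close> share the
      sign of \<open>\<sigma>\<close>, so the second factor is nonzero and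
      \<open>s = \<mu>\<close>.\<close>
    have "(\<mu> - s) * (\<beta> * x a + \<alpha> * x d) = 0"
      using arg_cong[OF ea, of "\<lambda>z. \<beta> * z"] arg_cong[OF ed, of "\<lambda>z. \<alpha> * z"]
      by (simp add: algebra_simps)
    moreover have "\<beta> * x a + \<alpha> * x d
        = \<sigma> * (\<beta> / (\<mu> + card (part a)) + \<alpha> / (\<mu> + card (part d)))"
      using adX by (simp add: xv algebra_simps)
    moreover have "\<beta> / (\<mu> + card (part a)) + \<alpha> / (\<mu> + card (part d)) > 0"
      using ab \<mu> card_part_pos adX by (intro add_pos_pos divide_pos_pos) auto
    ultimately have s: "\<mu> - s = 0" using \<sigma> by auto
    \<comment> \<open>With \<open>s = \<mu>\<close> and \<open>t = 0\<close> the image of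
      \<open>x\<close> under \<open>b\<close> vanishes on \<open>X\<close>, but at \<open>a\<close>
      it equals the nonzero \<open>x d\<close>.\<close>
    then have "t = 0" using ea ab by auto
    then have "mat_act X b x a = 0" using st[OF adX(1)] Aact[OF adX(1)] s by simp
    moreover have "mat_act X b x a = x d"
      using adX finite_X b_row[OF ad]
      by (simp add: mat_act_def if_distrib[of "\<lambda>x. x * _"] cong: if_cong)
    ultimately show False using xv[OF adX(2)] \<sigma> \<mu> by simp
  qed
qed

end

section \<open>Lower bounds for the spectral radius, and assembly of the proof\<close>

lemma adjacency_eq_1: "adjacency E u v = 1 \<longleftrightarrow> {u, v} \<in> E"
  by (simp add: adjacency_def)

lemma path_spectral_radius:
  assumes "finite Y" and abc: "{c, a} \<in> S" "{c, b} \<in> S" "a \<noteq> b" "a \<noteq> c" "b \<noteq> c" "{a, b, c} \<subseteq> Y"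
    and r: "\<And>f. quad_form Y (adjacency S) f \<le> r * inner_on Y f f"
  shows "r \<ge> 4 / 3"
proof -
  \<comment> \<open>The weight \<open>3 / 2\<close> is a rational stand-in for
    \<open>sqrt 2\<close>, the optimal weight at the centre of a path on three vertices. The
    quotient is \<open>6 / (17 / 4) = 24 / 17\<close>, which exceeds \<open>4 / 3\<close>.\<close>
  define f where "f u = (if u = c then 3 / 2 else if u \<in> {a, b} then 1 else 0 :: real)" for u
  have "(\<Sum>(u, v)\<in>{(a, c), (c, a), (b, c), (c, b)}. adjacency S u v * (f u * f v)) \<le> quad_form Y (adjacency S) f"
    using assms(1) abc by (intro quad_form_ge_pairs) (auto simp: adjacency_def f_def)
  then have "6 \<le> quad_form Y (adjacency S) f"
    using abc by (simp add: adjacency_def f_def insert_commute)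
  moreover have "inner_on Y f f = (\<Sum>u\<in>{a, b, c}. f u * f u)"
    unfolding inner_on_def using assms(1) abc
    by (intro sum.mono_neutral_right) (auto simp: f_def)
  then have ff: "inner_on Y f f = 17 / 4"
    using abc by (simp add: f_def)
  ultimately show ?thesis using r[of f] unfolding ff by simp
qed

lemma edge_spectral_radius:
  assumes "finite Y" and ab: "{a, b} \<in> S" "a \<noteq> b" "{a, b} \<subseteq> Y"
    and r: "\<And>f. quad_form Y (adjacency S) f \<le> r * inner_on Y f f"
  shows "r \<ge> 1"
proof -
  define f where "f u = (if u \<in> {a, b} then 1 else 0 :: real)" for u
  have "(\<Sum>(u, v)\<in>{(a, b), (b, a)}. adjacency S u v * (f u * f v)) \<le> quad_form Y (adjacency S) f"
    using assms(1) ab by (intro quad_form_ge_pairs) (auto simp: adjacency_def f_def)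
  then have "2 \<le> quad_form Y (adjacency S) f"
    using ab by (simp add: adjacency_def f_def insert_commute)
  moreover have "inner_on Y f f = (\<Sum>u\<in>{a, b}. f u * f u)"
    unfolding inner_on_def using assms(1) ab
    by (intro sum.mono_neutral_right) (auto simp: f_def)
  then have ff: "inner_on Y f f = 2"
    using ab by (simp add: f_def)
  ultimately show ?thesis using r[of f] unfolding ff by simp
qed

theorem theorem2:
  fixes k :: nat and t :: "nat \<Rightarrow> nat" and V U :: "nat \<Rightarrow> 'a set"
    and G H :: "'a ugraph" and S :: "'a set set"
  assumes "k \<ge> 2"
    and "\<And>i. i \<in> {1..k} \<Longrightarrow> finite (V i) \<and> V i \<noteq> {} \<and> card (V i) = t i"
    and "disjoint_family_on V {1..k}"
    and "G = complete_multipartite k V"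
    and "S \<subseteq> edges G" and "S \<noteq> {}"
    and "H = edge_induced_subgraph S"
    and "\<And>i. i \<in> {1..k} \<Longrightarrow> U i = verts H \<inter> V i"
    and "\<And>i. i \<in> {1..k} \<Longrightarrow>
           real (card (V i)) \<ge> 2 * graph_spectral_radius H * real (card (U i))"
  shows "graph_energy (delete_edges G S) > graph_energy G"
proof -
  let ?X = "verts G" and ?Y = "verts H" and ?r = "graph_spectral_radius H"
  have sG: "simple_graph G"
    using simple_graph_complete_multipartite assms(2-4) by blast
  have sH: "simple_graph H"
    using simple_graph_edge_induced_subgraph[OF sG assms(5)] assms(7) by simp
  have sD: "simple_graph (delete_edges G S)"
    using simple_graph_delete_edges[OF sG] .
  have fin: "finite ?X" and finY: "finite ?Y" using sG sH by (auto simp: simple_graph_def)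
  have XV: "?X = (\<Union>i\<in>{1..k}. V i)"
    and edges: "edges G = {{u, v} | u v i j.
      i \<in> {1..k} \<and> j \<in> {1..k} \<and> i \<noteq> j \<and> u \<in> V i \<and> v \<in> V j}"
    by (simp_all add: assms(4) complete_multipartite_def)
  have YS: "?Y = \<Union>S" and HS: "edges H = S" by (simp_all add: assms(7) edge_induced_subgraph_def)
  have YX: "?Y \<subseteq> ?X" using assms(5) sG unfolding YS by (auto simp: simple_graph_def)
  \<comment> \<open>The label of a vertex is the index of its part, well defined by disjointness.
    Off the vertex set its value is arbitrary.\<close>
  define p where "p u = (THE i. i \<in> {1..k} \<and> u \<in> V i)" for u
  have p: "p u = i" if "i \<in> {1..k}" "u \<in> V i" for u i
    unfolding p_def
  proof (rule the_equality)
    show "j = i" if "j \<in> {1..k} \<and> u \<in> V j" for j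
      using that \<open>i \<in> {1..k}\<close> \<open>u \<in> V i\<close> assms(3)
      unfolding disjoint_family_on_def by blast
  qed (use that in simp)
  have pX: "p u \<in> {1..k}" "u \<in> V (p u)" if "u \<in> ?X" for u
    using that p unfolding XV by auto
  interpret partition ?X p by standard (rule fin)
  have part: "part u = V (p u)" if "u \<in> ?X" for u
  proof (intro subset_antisym subsetI)
    fix v
    show "v \<in> part u \<Longrightarrow> v \<in> V (p u)"
      using pX(2)[of v] by (simp add: part_def)
    show "v \<in> V (p u) \<Longrightarrow> v \<in> part u"
      using pX(1)[OF that] p[of "p u" v] unfolding part_def unfolding XV by auto
  qed
  have edge_iff: "{u, v} \<in> edges G \<longleftrightarrow> p u \<noteq> p v" if "u \<in> ?X" "v \<in> ?X" for u v
  proof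
    assume "{u, v} \<in> edges G"
    then obtain u' v' i j where uv: "{u, v} = {u', v'}" "i \<in> {1..k}" "j \<in> {1..k}" "i \<noteq> j"
      "u' \<in> V i" "v' \<in> V j"
      unfolding edges by blast
    then have "p u' \<noteq> p v'" using p[of i u'] p[of j v'] by simp
    then show "p u \<noteq> p v" using uv(1) by (auto simp: doubleton_eq_iff)
  next
    assume "p u \<noteq> p v"
    then show "{u, v} \<in> edges G" unfolding edges using pX that by blast
  qed
  have adjG: "adjacency (edges G) u v = multipartite u v" if "u \<in> ?X" "v \<in> ?X" for u v
    using edge_iff[OF that] by (simp add: adjacency_def multipartite_def)
  have adjD: "adjacency (edges G - S) u v = multipartite u v - adjacency S u v" if "u \<in> ?X" "v \<in> ?X" for u v
    using edge_iff[OF that] assms(5) by (auto simp: adjacency_def multipartite_def)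
  have eb_cong: "eigenbasis ?X M' n l w"
    if "eigenbasis ?X M n l w" "\<And>u v. u \<in> ?X \<Longrightarrow> v \<in> ?X \<Longrightarrow> M u v = M' u v"
    for M M' :: "'a \<Rightarrow> 'a \<Rightarrow> real" and n l w
    using that unfolding eigenbasis_def mat_act_def by (simp cong: sum.cong)
  obtain nG lG wG where eG: "eigenbasis ?X (adjacency (edges G)) nG lG wG"
    and specG: "adj_spectrum G = image_mset lG (mset_set {..<nG})" and trG: "(\<Sum>j<nG. lG j) = 0"
    using graph_eigenbasis[OF sG] by blast
  obtain n l w where eD: "eigenbasis ?X (adjacency (edges G - S)) n l w"
    and specD: "adj_spectrum (delete_edges G S) = image_mset l (mset_set {..<n})"
    and trD: "(\<Sum>j<n. l j) = 0"
    using graph_eigenbasis[OF sD] by (auto simp: delete_edges_def)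
  have S_edge: "u \<in> ?Y \<and> v \<in> ?Y \<and> p u \<noteq> p v" if "{u, v} \<in> S" for u v
  proof -
    have "u \<in> ?Y" "v \<in> ?Y" using that unfolding YS by auto
    moreover have "{u, v} \<in> edges G" using that assms(5) by blast
    ultimately show ?thesis using edge_iff[of u v] YX by auto
  qed
  obtain e where "e \<in> S" using assms(6) by blast
  then obtain a d where ad: "{a, d} \<in> S" using assms(5) edges by auto
  note adY = S_edge[OF ad]
  obtain h where h: "\<And>u. h u \<ge> 0" "inner_on ?Y h h = 1"
    "\<And>u. u \<in> ?Y \<Longrightarrow> mat_act ?Y (adjacency S) h u = ?r * h u"
    and rayleigh: "\<And>f. quad_form ?Y (adjacency S) f \<le> ?r * inner_on ?Y f f"
    using graph_perron[OF sH] adY unfolding HS by blast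
  have r1: "?r \<ge> 1"
    using edge_spectral_radius[OF finY ad _ _ rayleigh] adY by auto
  have eG': "eigenbasis ?X multipartite nG lG wG"
    using eb_cong[OF eG] adjG by blast
  have adX: "a \<in> ?X" "d \<in> ?X" "p a \<noteq> p d" using adY YX by auto
  from multipartite_perron[OF eG' trG adX] obtain \<mu> x \<sigma>
    where \<mu>: "\<mu> > 0" and EG: "(\<Sum>j<nG. \<bar>lG j\<bar>) = 2 * \<mu>" and x: "inner_on ?X x x = 1" "\<sigma> \<noteq> 0"
      "\<forall>u\<in>?X. mat_act ?X multipartite x u = \<mu> * x u" "\<forall>u\<in>?X. (\<mu> + card (part u)) * x u = \<sigma>"
    by (elim exE conjE) (rule that; assumption)
  interpret sparse_deletion ?X p "adjacency S" ?Y ?r \<mu> \<sigma> x n l w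
  proof (rule sparse_deletion.intro[OF partition_axioms], rule sparse_deletion_axioms.intro)
    show "eigenbasis ?X (\<lambda>u v. multipartite u v - adjacency S u v) n l w"
      by (rule eb_cong[OF eD]) (rule adjD)
    show "2 * ?r * card (?Y \<inter> part u) \<le> card (part u)" if "u \<in> ?X" for u
      using assms(8,9)[OF pX(1)[OF that]] part[OF that] by simp
    show "adjacency S u v = 0 \<or> adjacency S u v = 1" for u v by (simp add: adjacency_def)
    show "u \<in> ?Y \<and> v \<in> ?Y \<and> p u \<noteq> p v" if "adjacency S u v = 1" for u v
      using S_edge that by (simp add: adjacency_eq_1)
    show "\<mu> > 0" "\<sigma> \<noteq> 0" "inner_on ?X x x = 1" by fact+
  qed (use r1 x YX trD in \<open>auto intro: rayleigh adjacency_commute\<close>)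
  have "2 * \<mu> < (\<Sum>j<n. \<bar>l j\<bar>)"
  \<comment> \<open>The condition says that \<open>S\<close> is a matching. If it fails, two edges
    of \<open>S\<close> share a vertex and the bound \<open>4 / 3\<close> becomes available.\<close>
  proof (cases "\<forall>u v v'. {u, v} \<in> S \<longrightarrow> {u, v'} \<in> S \<longrightarrow> v = v'")
    case True
    show ?thesis
      by (rule energy_gt_matching[OF r1, of a d]) (use True ad in \<open>auto simp: adjacency_eq_1\<close>)
  next
    case False
    then obtain c b b' where bb: "{c, b} \<in> S" "{c, b'} \<in> S" "b \<noteq> b'" by blast
    have "?r \<ge> 4 / 3"
      by (rule path_spectral_radius[OF finY bb _ _ _ rayleigh])
        (use S_edge[OF bb(1)] S_edge[OF bb(2)] in auto)
    \<comment> \<open>The Perron vector of \<open>H\<close> is extended by zero to \<open>X\<close>.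
      It remains an eigenvector because \<open>adjacency S\<close> vanishes outside the vertices of
      \<open>H\<close>.\<close>
    moreover define h' where "h' u = (if u \<in> ?Y then h u else 0)" for u
    have "inner_on ?X h' h' = 1"
      unfolding h(2)[symmetric] inner_on_def
      by (rule sum.mono_neutral_cong_right[OF fin YX]) (auto simp: h'_def)
    moreover have "mat_act ?X (adjacency S) h' u = ?r * h' u" for u
    proof (cases "u \<in> ?Y")
      case True
      have "mat_act ?X (adjacency S) h' u = mat_act ?Y (adjacency S) h u"
        unfolding mat_act_def
        by (rule sum.mono_neutral_cong_right[OF fin YX]) (auto simp: h'_def)
      then show ?thesis using True h(3) by (simp add: h'_def)
    next
      case False
      then show ?thesis by (simp add: mat_act_def b_outside h'_def)
    qed
    ultimately show ?thesis
      using h(1) by (intro energy_gt_dense[of h']) (auto simp: h'_def)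
  qed
  then show ?thesis
    unfolding graph_energy_spectrum[OF specG] graph_energy_spectrum[OF specD] EG .
qed

end
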